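(* Let $h$ be a flat metric on $T^2$, normalized up to isometry and scaling as a positive multiple of some $h_{a,b}$ with $0\le a\le 1/2$, $b\ge\sqrt{1-a^2}$, on $T^2=\mathbb{R}^2/\mathbb{Z}^2$. Then there exists an isometric embedding $\varphi\colon(T^2,h)\to\mathbb{R}^6$ by first eigenfunctions of the equilateral flat metric $h_{\mathrm{EL}}$. In particular, the map $\varphi$ is an inflated map with respect to $(d\mu_h,h)$, and the metric $g^*=h_{\mathrm{EL}}^*$ is a solution to the first-eigenvalue maximization problem associated with $(d\mu_h,h)$. If $h$ is a rectangular flat metric, that is, a flat metric corresponding to a rectangular lattice ($a=0$), then the image of $\varphi$ lies in $\mathbb{R}^4$ and the square flat metric $h_{\mathrm{SQ}}$ provides another solution $h_{\mathrm{SQ}}^*$ to the first-eigenvalue maximization problem associated with $(d\mu_h,h)$. Moreover, the metrics $h_{a,\sqrt{1-a^2}}^*$, $0\le a\le1/2$, joining $h_{\mathrm{EL}}^*$ and $h_{\mathrm{SQ}}^*$, all provide solutions to that same problem for rectangular $h$.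
   Context: For $0\le a\le1/2$ and $b\ge\sqrt{1-a^2}$, $h_{a,b}=dx^2+2a\,dx\,dy+(a^2+b^2)\,dy^2$ is the flat metric on $T^2=\mathbb{R}^2/\mathbb{Z}^2$ obtained by pulling back the Euclidean metric of $\mathbb{R}^2/(\mathbb{Z}(1,0)\oplus\mathbb{Z}(a,b))$ via the linear isomorphism fixing $(1,0)$ and sending $(0,1)$ to $(a,b)$. Every flat metric on $T^2$ is, up to isometry and scaling, one of these. $h_{\mathrm{EL}}=h_{1/2,\sqrt3/2}=dx^2+dx\,dy+dy^2$ and $h_{\mathrm{SQ}}=h_{0,1}=dx^2+dy^2$. For a Riemannian metric $g$, $d\mu_g$ is its volume element, $\Delta_g$ its Laplacian, $g^*$ the dual metric on the cotangent bundle. First eigenfunctions of $g$ are elements of the eigenspace of $-\Delta_g$ for its smallest positive eigenvalue; a map is "by first eigenfunctions" if every component lies in that eigenspace (zero components allowed). $\mathbb{R}^4\subset\mathbb{R}^6$ denotes a coordinate subspace. On a compact manifold $M$ (connected, without boundary) with smooth volume element $d\mu$ and Riemannian metric $h$, put $d\mu_1=d\mu/\int_M d\mu$. $\mathcal{M}^*$ is the set of all smooth sections $g^*$ of $S^2TM$ that are positive semidefinite on $T^*M$ at every point; $(g^*,h)=g^{ij}h_{ij}$; $\lambda_1(d\mu,g^* )=\inf\int_M g^*(du,du)\,d\mu\big/\int_M u^2\,d\mu$, the infimum over nonzero $C^1$-functions $u$ with $\int_M u\,d\mu=0$. The first-eigenvalue maximization problem associated with $(d\mu,h)$: over all nonzero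 $g^*\in\mathcal{M}^*$, maximize $\lambda_1(d\mu,g^* )\big/\int_M(g^*,h)\,d\mu_1$; a solution is a $g^*$ attaining the maximum. Let $l^2$ be the Hilbert space of square-summable real sequences with standard metric $h_{l^2}$ and norm $\|\cdot\|$. An inflated map with respect to $(d\mu,h)$ is a $C^\infty$-map $\varphi\colon M\to l^2$ that maximizes $\int_M\|\varphi\|^2\,d\mu_1$ among all $C^\infty$-maps $M\to l^2$ satisfying $\varphi^*h_{l^2}\le h$ and $\int_M\varphi\,d\mu_1=0$. Maps into $\mathbb{R}^N$ are regarded as maps into $l^2$ via a standard linear isometric inclusion. *)

theory Defs
  imports "HOL-Analysis.Analysis"
begin

section \<open>The Hilbert space of square-summable real sequences\<close>

typedef l2 = "{f :: nat \<Rightarrow> real. summable (\<lambda>n. (f n)\<^sup>2)}"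
  morphisms l2_nth Abs_l2
  by (rule exI[of _ "\<lambda>_. 0"]) simp

setup_lifting type_definition_l2

lemma summable_l2_mult:
  fixes f g :: "nat \<Rightarrow> real"
  assumes "summable (\<lambda>n. (f n)\<^sup>2)" "summable (\<lambda>n. (g n)\<^sup>2)"
  shows "summable (\<lambda>n. f n * g n)"
proof (rule summable_comparison_test')
  show "summable (\<lambda>n. (f n)\<^sup>2 + (g n)\<^sup>2)"
    using assms by (rule summable_add)
  fix n
  have "0 \<le> (\<bar>f n\<bar> - \<bar>g n\<bar>)\<^sup>2" by simp
  then have "2 * (\<bar>f n\<bar> * \<bar>g n\<bar>) \<le> (f n)\<^sup>2 + (g n)\<^sup>2"
    by (simp add: power2_diff)
  moreover have "0 \<le> \<bar>f n\<bar> * \<bar>g n\<bar>" by simp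
  ultimately show "norm (f n * g n) \<le> (f n)\<^sup>2 + (g n)\<^sup>2"
    unfolding real_norm_def abs_mult by linarith
qed

lemma summable_l2_add:
  fixes f g :: "nat \<Rightarrow> real"
  assumes "summable (\<lambda>n. (f n)\<^sup>2)" "summable (\<lambda>n. (g n)\<^sup>2)"
  shows "summable (\<lambda>n. (f n + g n)\<^sup>2)"
proof -
  have "summable (\<lambda>n. (f n)\<^sup>2 + (g n)\<^sup>2 + 2 * (f n * g n))"
    by (intro summable_add summable_mult summable_l2_mult assms)
  then show ?thesis by (simp add: power2_sum mult.assoc)
qed

lemma summable_l2_scale:
  fixes f :: "nat \<Rightarrow> real"
  assumes "summable (\<lambda>n. (f n)\<^sup>2)"
  shows "summable (\<lambda>n. (r * f n)\<^sup>2)"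
  using summable_mult[OF assms, of "r\<^sup>2"] by (simp add: power_mult_distrib)

instantiation l2 :: real_vector
begin

lift_definition zero_l2 :: l2 is "\<lambda>_. 0" by simp
lift_definition plus_l2 :: "l2 \<Rightarrow> l2 \<Rightarrow> l2" is "\<lambda>f g n. f n + g n"
  by (rule summable_l2_add)
lift_definition uminus_l2 :: "l2 \<Rightarrow> l2" is "\<lambda>f n. - f n" by simp
lift_definition minus_l2 :: "l2 \<Rightarrow> l2 \<Rightarrow> l2" is "\<lambda>f g n. f n - g n"
  subgoal for f g using summable_l2_add[of f "\<lambda>n. - g n"] by simp
  done
lift_definition scaleR_l2 :: "real \<Rightarrow> l2 \<Rightarrow> l2" is "\<lambda>r f n. r * f n"
  by (rule summable_l2_scale)

instance
proof
  fix x y z :: l2 and r s :: real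
  show "x + y + z = x + (y + z)" by transfer (simp add: add.assoc)
  show "x + y = y + x" by transfer (simp add: add.commute)
  show "0 + x = x" by transfer simp
  show "- x + x = 0" by transfer simp
  show "x - y = x + - y" by transfer simp
  show "r *\<^sub>R (x + y) = r *\<^sub>R x + r *\<^sub>R y" by transfer (simp add: algebra_simps)
  show "(r + s) *\<^sub>R x = r *\<^sub>R x + s *\<^sub>R x" by transfer (simp add: algebra_simps)
  show "r *\<^sub>R s *\<^sub>R x = (r * s) *\<^sub>R x" by transfer (simp add: algebra_simps)
  show "1 *\<^sub>R x = x" by transfer simp
qed

end

instantiation l2 :: real_inner
begin

lift_definition inner_l2 :: "l2 \<Rightarrow> l2 \<Rightarrow> real" is "\<lambda>f g. \<Sum>n. f n * g n" .

definition norm_l2 :: "l2 \<Rightarrow> real" where "norm_l2 x = sqrt (inner x x)"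
definition dist_l2 :: "l2 \<Rightarrow> l2 \<Rightarrow> real" where "dist_l2 x y = norm (x - y)"
definition sgn_l2 :: "l2 \<Rightarrow> l2" where "sgn_l2 x = x /\<^sub>R norm x"
definition uniformity_l2 :: "(l2 \<times> l2) filter"
  where "uniformity_l2 = (INF e\<in>{0 <..}. principal {(x, y). dist x y < e})"
definition open_l2 :: "l2 set \<Rightarrow> bool"
  where "open_l2 U = (\<forall>x\<in>U. eventually (\<lambda>(x', y). x' = x \<longrightarrow> y \<in> U) uniformity)"

instance
proof
  fix x y z :: l2 and r :: real
  show "dist x y = norm (x - y)" by (rule dist_l2_def)
  show "sgn x = x /\<^sub>R norm x" by (rule sgn_l2_def)
  show "uniformity = (INF e\<in>{0 <..}. principal {(x :: l2, y). dist x y < e})"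
    by (rule uniformity_l2_def)
  show "open U = (\<forall>x\<in>U. eventually (\<lambda>(x', y). x' = x \<longrightarrow> y \<in> U) uniformity)" for U :: "l2 set"
    by (rule open_l2_def)
  show "inner x y = inner y x" by transfer (simp add: mult.commute)
  show "inner (x + y) z = inner x z + inner y z"
    by transfer (simp add: distrib_right suminf_add summable_l2_mult)
  show "inner (r *\<^sub>R x) y = r * inner x y"
    by transfer (simp add: mult.assoc suminf_mult summable_l2_mult)
  show "0 \<le> inner x x"
    by transfer (auto intro: suminf_nonneg simp flip: power2_eq_square)
  show "inner x x = 0 \<longleftrightarrow> x = 0"
  proof transfer
    fix f :: "nat \<Rightarrow> real" assume "summable (\<lambda>n. (f n)\<^sup>2)"
    then have "(\<Sum>n. (f n)\<^sup>2) = 0 \<longleftrightarrow> (\<forall>n. (f n)\<^sup>2 = 0)"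
      by (rule suminf_eq_zero_iff) simp
    then show "(\<Sum>n. f n * f n) = 0 \<longleftrightarrow> f = (\<lambda>_. 0)"
      by (simp add: power2_eq_square fun_eq_iff)
  qed
  show "norm x = sqrt (inner x x)" by (rule norm_l2_def)
qed

end

lemma summable_l2_nth: "summable (\<lambda>n. (l2_nth x n)\<^sup>2)"
  using l2_nth[of x] by simp

lemma norm_l2_sums: "(\<lambda>n. (l2_nth x n)\<^sup>2) sums (norm x)\<^sup>2"
proof -
  have "(norm x)\<^sup>2 = (\<Sum>n. (l2_nth x n)\<^sup>2)"
    by (simp only: power2_norm_eq_inner, transfer) (simp add: power2_eq_square)
  then show ?thesis using summable_l2_nth[of x] by (simp add: summable_sums)
qed

lemma sum_l2_le_norm: "(\<Sum>n<N. (l2_nth x n)\<^sup>2) \<le> (norm x)\<^sup>2"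
  using norm_l2_sums[of x] by (metis sum_le_suminf sums_iff finite_lessThan zero_le_power2)

lemma l2_nth_diff: "l2_nth (x - y) n = l2_nth x n - l2_nth y n"
  by transfer simp

lemma abs_l2_nth_le_norm: "\<bar>l2_nth x n\<bar> \<le> norm x"
proof -
  have "(l2_nth x n)\<^sup>2 \<le> (\<Sum>k<Suc n. (l2_nth x k)\<^sup>2)" by (simp add: sum_nonneg)
  also have "\<dots> \<le> (norm x)\<^sup>2" by (rule sum_l2_le_norm)
  finally show ?thesis using abs_le_square_iff[of "l2_nth x n" "norm x"] by simp
qed

instance l2 :: banach
proof
  fix X :: "nat \<Rightarrow> l2" assume X: "Cauchy X"
  have "Cauchy (\<lambda>m. l2_nth (X m) n)" for n
  proof (rule metric_CauchyI)
    fix e :: real assume "0 < e"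
    then obtain M where "\<And>m k. m \<ge> M \<Longrightarrow> k \<ge> M \<Longrightarrow> dist (X m) (X k) < e"
      using metric_CauchyD[OF X] by blast
    then show "\<exists>M. \<forall>m\<ge>M. \<forall>k\<ge>M. dist (l2_nth (X m) n) (l2_nth (X k) n) < e"
      by (metis abs_l2_nth_le_norm dist_norm l2_nth_diff order.strict_trans1 real_norm_def)
  qed
  then have "\<exists>l. (\<lambda>m. l2_nth (X m) n) \<longlonglongrightarrow> l" for n
    by (simp add: real_Cauchy_convergent flip: convergent_def)
  then obtain L where L: "\<And>n. (\<lambda>m. l2_nth (X m) n) \<longlonglongrightarrow> L n"
    by metis
  have bound: "summable (\<lambda>n. (l2_nth (X m) n - L n)\<^sup>2) \<and> (\<Sum>n. (l2_nth (X m) n - L n)\<^sup>2) \<le> e\<^sup>2"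
    if e: "\<And>k. k \<ge> M \<Longrightarrow> dist (X m) (X k) < e" for m M e
  proof -
    have part: "(\<Sum>n<N. (l2_nth (X m) n - L n)\<^sup>2) \<le> e\<^sup>2" for N
    proof (rule tendsto_upperbound)
      show "(\<lambda>k. \<Sum>n<N. (l2_nth (X m) n - l2_nth (X k) n)\<^sup>2) \<longlonglongrightarrow> (\<Sum>n<N. (l2_nth (X m) n - L n)\<^sup>2)"
        by (intro tendsto_intros L)
      have "(\<Sum>n<N. (l2_nth (X m) n - l2_nth (X k) n)\<^sup>2) \<le> e\<^sup>2" if "k \<ge> M" for k
      proof -
        have "(norm (X m - X k))\<^sup>2 \<le> e\<^sup>2"
          using e[OF that] by (intro power_mono) (simp_all add: dist_norm)
        then show ?thesis
          using sum_l2_le_norm[where x = "X m - X k" and N = N] by (simp add: l2_nth_diff)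
      qed
      then show "\<forall>\<^sub>F k in sequentially. (\<Sum>n<N. (l2_nth (X m) n - l2_nth (X k) n)\<^sup>2) \<le> e\<^sup>2"
        using eventually_sequentially by blast
    qed simp
    have "summable (\<lambda>n. (l2_nth (X m) n - L n)\<^sup>2)"
      by (rule summableI_nonneg_bounded[OF _ part]) simp
    with part show ?thesis by (auto intro: suminf_le_const)
  qed
  have "summable (\<lambda>n. (L n)\<^sup>2)"
  proof -
    obtain M where "\<And>m k. m \<ge> M \<Longrightarrow> k \<ge> M \<Longrightarrow> dist (X m) (X k) < 1"
      using metric_CauchyD[OF X, of 1] by auto
    then have s: "summable (\<lambda>n. (l2_nth (X M) n - L n)\<^sup>2)" using bound[of M M 1] by blast
    have s': "summable (\<lambda>n. (- (l2_nth (X M) n - L n))\<^sup>2)" using s by (simp only: power2_minus)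
    show ?thesis using summable_l2_add[OF summable_l2_nth[of "X M"] s'] by simp
  qed
  then have nth_L: "l2_nth (Abs_l2 L) = L" by (simp add: Abs_l2_inverse)
  have "X \<longlonglongrightarrow> Abs_l2 L"
  proof (rule metric_LIMSEQ_I)
    fix e :: real assume "0 < e"
    then obtain M where M: "\<And>m k. m \<ge> M \<Longrightarrow> k \<ge> M \<Longrightarrow> dist (X m) (X k) < e / 2"
      using metric_CauchyD[OF X, of "e / 2"] by auto
    have "dist (X m) (Abs_l2 L) < e" if "m \<ge> M" for m
    proof -
      have "(norm (X m - Abs_l2 L))\<^sup>2 = (\<Sum>n. (l2_nth (X m) n - L n)\<^sup>2)"
        using norm_l2_sums[of "X m - Abs_l2 L"] by (simp add: sums_iff l2_nth_diff nth_L)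
      also have "\<dots> \<le> (e / 2)\<^sup>2" using bound[of M m "e / 2"] M[OF that] by blast
      finally have "norm (X m - Abs_l2 L) \<le> e / 2"
        by (rule power2_le_imp_le) (use \<open>0 < e\<close> in simp)
      then show ?thesis using \<open>0 < e\<close> by (simp add: dist_norm)
    qed
    then show "\<exists>M. \<forall>m\<ge>M. dist (X m) (Abs_l2 L) < e" by blast
  qed
  then show "convergent X" by (rule convergentI)
qed

text \<open>The inclusion of \<open>\<real>\<^sup>6\<close> into the first six coordinates; \<open>of_nat\<close> enumerates the
  index type \<open>6\<close>.\<close>

lift_definition l2_of_R6 :: "real ^ 6 \<Rightarrow> l2"
  is "\<lambda>v n. if n < 6 then v $ of_nat n else 0"
  by (rule summable_finite[of "{..<6}"]) auto

lemma bij_betw_of_nat_6: "bij_betw (of_nat :: nat \<Rightarrow> 6) {..<6} UNIV"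
proof -
  have inj: "inj_on (of_nat :: nat \<Rightarrow> 6) {..<6}"
  proof (rule inj_onI)
    fix m n :: nat
    assume "m \<in> {..<6}" "n \<in> {..<6}" and eq: "(of_nat m :: 6) = of_nat n"
    then have "Rep_bit0 (of_nat m :: 6) = Rep_bit0 (of_nat n :: 6)" by simp
    then show "m = n" using \<open>m \<in> _\<close> \<open>n \<in> _\<close>
      by (simp add: bit0.of_nat_eq Abs_bit0_inverse)
  qed
  then have "of_nat ` {..<6} = (UNIV :: 6 set)"
    by (intro card_subset_eq) (simp_all add: card_image)
  with inj show ?thesis by (simp add: bij_betw_def)
qed

lemma linear_l2_of_R6: "linear l2_of_R6"
  by (rule linearI; transfer) (auto simp: fun_eq_iff)

lemma inner_l2_of_R6: "inner (l2_of_R6 v) (l2_of_R6 w) = inner v w"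
proof -
  have "inner (l2_of_R6 v) (l2_of_R6 w) = (\<Sum>n<6. v $ of_nat n * w $ of_nat n)"
    by transfer (subst suminf_finite[of "{..<6}"], auto)
  also have "\<dots> = (\<Sum>i\<in>UNIV. v $ i * w $ i)"
    by (rule sum.reindex_bij_betw[OF bij_betw_of_nat_6])
  finally show ?thesis by (simp add: inner_vec_def)
qed


section \<open>Smooth maps\<close>

text \<open>On a finite-dimensional domain a map is of class \<open>C\<^sup>k\<^sup>+\<^sup>1\<close> iff it is differentiable and
  all its directional derivatives are of class \<open>C\<^sup>k\<close>.\<close>

primrec C_k :: "nat \<Rightarrow> ('a::euclidean_space \<Rightarrow> 'b::real_normed_vector) \<Rightarrow> bool" where
  "C_k 0 f \<longleftrightarrow> continuous_on UNIV f"
| "C_k (Suc k) f \<longleftrightarrow>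
     (\<forall>x. f differentiable (at x)) \<and> (\<forall>v. C_k k (\<lambda>x. frechet_derivative f (at x) v))"

definition smooth :: "('a::euclidean_space \<Rightarrow> 'b::real_normed_vector) \<Rightarrow> bool" where
  "smooth f \<longleftrightarrow> (\<forall>k. C_k k f)"


section \<open>Geometry of the torus\<close>

text \<open>Maps on \<open>T\<^sup>2 = \<real>\<^sup>2/\<int>\<^sup>2\<close> are \<open>\<int>\<^sup>2\<close>-periodic maps on \<open>\<real>\<^sup>2\<close>. In the global frame
  \<open>\<partial>\<^sub>x, \<partial>\<^sub>y\<close>, tensor fields on \<open>T\<^sup>2\<close> are periodic fields of \<open>2\<times>2\<close> matrices: \<open>h x $ i $ j\<close> is
  \<open>h\<^sub>i\<^sub>j\<close> for a metric and \<open>g\<^sup>i\<^sup>j\<close> for a section of \<open>S\<^sup>2TM\<close>. A volume element is \<open>\<rho> dx dy\<close>, given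
  by its density \<open>\<rho>\<close>.\<close>

type_synonym tensor_field = "real ^ 2 \<Rightarrow> real ^ 2 ^ 2"

definition lattice :: "(real ^ 2) set" where
  "lattice = {z. \<forall>i. z $ i \<in> \<int>}"

definition periodic :: "(real ^ 2 \<Rightarrow> 'a) \<Rightarrow> bool" where
  "periodic f \<longleftrightarrow> (\<forall>x. \<forall>z\<in>lattice. f (x + z) = f x)"

definition torus_integral :: "(real ^ 2 \<Rightarrow> real) \<Rightarrow> (real ^ 2 \<Rightarrow> 'b::banach) \<Rightarrow> 'b" where
  "torus_integral \<rho> f = integral (cbox 0 (\<chi> i. 1)) (\<lambda>x. \<rho> x *\<^sub>R f x)"

text \<open>Integration against \<open>d\<mu>\<^sub>1 = d\<mu> / \<integral> d\<mu>\<close>.\<close>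

definition torus_mean :: "(real ^ 2 \<Rightarrow> real) \<Rightarrow> (real ^ 2 \<Rightarrow> 'b::banach) \<Rightarrow> 'b" where
  "torus_mean \<rho> f = torus_integral \<rho> f /\<^sub>R torus_integral \<rho> (\<lambda>_. 1)"

definition partial :: "2 \<Rightarrow> (real ^ 2 \<Rightarrow> real) \<Rightarrow> real ^ 2 \<Rightarrow> real" where
  "partial i u x = frechet_derivative u (at x) (axis i 1)"

definition differential :: "(real ^ 2 \<Rightarrow> real) \<Rightarrow> real ^ 2 \<Rightarrow> real ^ 2" where
  "differential u x = (\<chi> i. partial i u x)"

definition volume_density :: "tensor_field \<Rightarrow> real ^ 2 \<Rightarrow> real" where
  "volume_density g x = sqrt (det (g x))"

definition dual_metric :: "tensor_field \<Rightarrow> tensor_field" where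
  "dual_metric g x = matrix_inv (g x)"

definition laplacian :: "tensor_field \<Rightarrow> (real ^ 2 \<Rightarrow> real) \<Rightarrow> real ^ 2 \<Rightarrow> real" where
  "laplacian g u x =
     (\<Sum>i\<in>UNIV. partial i
        (\<lambda>y. volume_density g y * (\<Sum>j\<in>UNIV. dual_metric g y $ i $ j * partial j u y)) x)
      / volume_density g x"

definition eigenspace :: "tensor_field \<Rightarrow> real \<Rightarrow> (real ^ 2 \<Rightarrow> real) set" where
  "eigenspace g \<mu> = {u. smooth u \<and> periodic u \<and> (\<forall>x. - laplacian g u x = \<mu> * u x)}"

definition eigenvalue :: "tensor_field \<Rightarrow> real \<Rightarrow> bool" where
  "eigenvalue g \<mu> \<longleftrightarrow> (\<exists>u\<in>eigenspace g \<mu>. u \<noteq> (\<lambda>_. 0))"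

definition is_first_eigenvalue :: "tensor_field \<Rightarrow> real \<Rightarrow> bool" where
  "is_first_eigenvalue g \<mu> \<longleftrightarrow>
     0 < \<mu> \<and> eigenvalue g \<mu> \<and> (\<forall>\<nu>. 0 < \<nu> \<and> eigenvalue g \<nu> \<longrightarrow> \<mu> \<le> \<nu>)"

definition by_first_eigenfunctions :: "tensor_field \<Rightarrow> (real ^ 2 \<Rightarrow> real ^ 'n) \<Rightarrow> bool" where
  "by_first_eigenfunctions g \<phi> \<longleftrightarrow>
     (\<exists>\<mu>. is_first_eigenvalue g \<mu> \<and> (\<forall>i. (\<lambda>x. \<phi> x $ i) \<in> eigenspace g \<mu>))"

text \<open>An injective isometric immersion of the compact manifold \<open>T\<^sup>2\<close> is an embedding.\<close>

definition isometric_embedding ::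
    "tensor_field \<Rightarrow> (real ^ 2 \<Rightarrow> 'b::real_inner) \<Rightarrow> bool" where
  "isometric_embedding h \<phi> \<longleftrightarrow>
     smooth \<phi> \<and> periodic \<phi> \<and>
     (\<forall>x y. \<phi> x = \<phi> y \<longrightarrow> x - y \<in> lattice) \<and>
     (\<forall>x v w. frechet_derivative \<phi> (at x) v \<bullet> frechet_derivative \<phi> (at x) w = v \<bullet> (h x *v w))"


section \<open>The first-eigenvalue maximization problem\<close>

definition M_star :: "tensor_field set" where
  "M_star = {g. smooth g \<and> periodic g \<and>
     (\<forall>x. transpose (g x) = g x) \<and> (\<forall>x \<xi>. 0 \<le> \<xi> \<bullet> (g x *v \<xi>))}"

definition pairing :: "tensor_field \<Rightarrow> tensor_field \<Rightarrow> real ^ 2 \<Rightarrow> real" where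
  "pairing g h x = (\<Sum>i\<in>UNIV. \<Sum>j\<in>UNIV. g x $ i $ j * h x $ i $ j)"

definition lambda1 :: "(real ^ 2 \<Rightarrow> real) \<Rightarrow> tensor_field \<Rightarrow> real" where
  "lambda1 \<rho> g =
     Inf {torus_integral \<rho> (\<lambda>x. differential u x \<bullet> (g x *v differential u x))
            / torus_integral \<rho> (\<lambda>x. (u x)\<^sup>2) | u.
          C_k 1 u \<and> periodic u \<and> u \<noteq> (\<lambda>_. 0) \<and> torus_integral \<rho> u = 0}"

definition solves_maximization ::
    "(real ^ 2 \<Rightarrow> real) \<Rightarrow> tensor_field \<Rightarrow> tensor_field \<Rightarrow> bool" where
  "solves_maximization \<rho> h =
     is_arg_max (\<lambda>g. lambda1 \<rho> g / torus_mean \<rho> (pairing g h))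
       (\<lambda>g. g \<in> M_star \<and> g \<noteq> (\<lambda>_. 0))"


section \<open>Inflated maps\<close>

definition inflated :: "(real ^ 2 \<Rightarrow> real) \<Rightarrow> tensor_field \<Rightarrow> (real ^ 2 \<Rightarrow> l2) \<Rightarrow> bool" where
  "inflated \<rho> h =
     is_arg_max (\<lambda>\<phi>. torus_mean \<rho> (\<lambda>x. (norm (\<phi> x))\<^sup>2))
       (\<lambda>\<phi>. smooth \<phi> \<and> periodic \<phi> \<and>
          (\<forall>x v. (norm (frechet_derivative \<phi> (at x) v))\<^sup>2 \<le> v \<bullet> (h x *v v)) \<and>
          torus_mean \<rho> \<phi> = 0)"


section \<open>Flat metrics\<close>

definition h_flat :: "real \<Rightarrow> real \<Rightarrow> tensor_field" where
  "h_flat a b = (\<lambda>_. vector [vector [1, a], vector [a, a\<^sup>2 + b\<^sup>2]])"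

definition h_EL :: tensor_field where "h_EL = h_flat (1 / 2) (sqrt 3 / 2)"

definition h_SQ :: tensor_field where "h_SQ = h_flat 0 1"

lemma h_flat_pullback:
  fixes a b :: real and v w :: "real ^ 2"
  defines "L \<equiv> \<lambda>v :: real ^ 2. (v $ 1) *\<^sub>R vector [1, 0] + (v $ 2) *\<^sub>R vector [a, b] :: real ^ 2"
  shows "v \<bullet> (h_flat a b x *v w) = L v \<bullet> L w"
  by (simp add: L_def h_flat_def inner_vec_def matrix_vector_mult_def sum_2
      power2_eq_square algebra_simps)

lemma h_flat_unit_circle_endpoints:
  "h_flat (1 / 2) (sqrt (1 - (1 / 2)\<^sup>2)) = h_EL"
  "h_flat 0 (sqrt (1 - 0\<^sup>2)) = h_SQ"
  by (simp_all add: h_EL_def h_SQ_def power2_eq_square real_sqrt_divide)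

end

theory Submission
  imports Defs
begin

text \<open>
  Everything rests on the sharp Poincare inequality for the flat metrics \<open>h\<^sub>s\<^sub>,\<^sub>t\<close> with
  \<open>s\<^sup>2 + t\<^sup>2 = 1\<close> and \<open>0 \<le> s \<le> 1/2\<close>: their first eigenvalue is \<open>4\<pi>\<^sup>2/t\<^sup>2\<close>. For \<open>h\<^sub>E\<^sub>L\<close>, which
  is \<open>s = 1/2\<close>, the eigenspace contains the waves of the three frequencies \<open>(1,0)\<close>, \<open>(0,1)\<close>,
  \<open>(1,1)\<close>.

  The map \<open>\<phi>\<close> (\<open>hex_torus\<close>) is a product of three circles, one per frequency, with radii
  \<open>A\<^sub>0, A\<^sub>1, A\<^sub>2\<close>. It pulls the Euclidean metric back to
  \<open>4\<pi>\<^sup>2 (A\<^sub>0\<^sup>2 dx\<^sup>2 + A\<^sub>1\<^sup>2 dy\<^sup>2 + A\<^sub>2\<^sup>2 (dx + dy)\<^sup>2)\<close>, and the forms \<open>dx\<^sup>2\<close>, \<open>dy\<^sup>2\<close>, \<open>(dx + dy)\<^sup>2\<close> span the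
  constant symmetric forms. So the radii are determined by \<open>h = c h\<^sub>a\<^sub>,\<^sub>b\<close>, namely
  \<open>4\<pi>\<^sup>2 A\<^sub>0\<^sup>2 = c (1 - a)\<close>, \<open>4\<pi>\<^sup>2 A\<^sub>1\<^sup>2 = c (a\<^sup>2 + b\<^sup>2 - a)\<close>, \<open>4\<pi>\<^sup>2 A\<^sub>2\<^sup>2 = c a\<close>; the reduction of the
  lattice makes the right-hand sides nonnegative. If \<open>a = 0\<close> the third circle collapses and four
  coordinates remain. The image lies on a sphere of squared radius \<open>R = A\<^sub>0\<^sup>2 + A\<^sub>1\<^sup>2 + A\<^sub>2\<^sup>2\<close>.

  Both optimality claims are the two halves of a duality. Using the coordinates of \<open>\<phi>\<close> as test
  functions and summing gives \<open>\<lambda>\<^sub>1(g\<^sup>*) R \<le> \<integral> (g\<^sup>*, h)\<close> for every competitor \<open>g\<^sup>*\<close>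
  (\<open>lambda1_isometric_bound\<close>). Applying the Poincare inequality of \<open>h\<^sub>s\<^sub>,\<^sub>t\<close> to the coordinates of a
  map \<open>\<psi>\<close> with \<open>\<psi>\<^sup>*h\<^sub>l\<^sub>2 \<le> h\<close> gives \<open>(4\<pi>\<^sup>2/t\<^sup>2) \<integral> \<parallel>\<psi>\<parallel>\<^sup>2 \<le> \<integral> (h\<^sub>s\<^sub>,\<^sub>t\<^sup>*, h)\<close>
  (\<open>short_map_bound\<close>). Hence the single relation \<open>\<integral> (h\<^sub>s\<^sub>,\<^sub>t\<^sup>*, h) \<le> (4\<pi>\<^sup>2/t\<^sup>2) R\<close> shows that \<open>h\<^sub>s\<^sub>,\<^sub>t\<^sup>*\<close>
  is a solution and that \<open>\<phi>\<close> is inflated (\<open>solves_maximizationI\<close>, \<open>inflatedI\<close>). The left side is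
  \<open>c (1 - 2sa + a\<^sup>2 + b\<^sup>2)/t\<^sup>2\<close> and the right side \<open>c (1 - a + a\<^sup>2 + b\<^sup>2)/t\<^sup>2\<close>, so the relation holds
  for \<open>s = 1/2\<close>, and for every \<open>s\<close> when \<open>a = 0\<close>.

  The Poincare inequality (\<open>torus_poincare\<close>) is obtained from one variable, without Fourier series
  on the torus. Wirtinger's inequality along the closed lines in a lattice direction \<open>e\<close> bounds
  \<open>\<integral> (\<partial>\<^sub>e u)\<^sup>2\<close> below by \<open>4\<pi>\<^sup>2 (\<parallel>u\<parallel>\<^sup>2 - \<parallel>u\<^sub>e\<parallel>\<^sup>2)\<close>, where \<open>u\<^sub>e\<close> is the average of \<open>u\<close> over these lines.
  For a mean-zero \<open>u\<close> the averages in the directions \<open>(1,0)\<close>, \<open>(0,1)\<close>, \<open>(1,-1)\<close> are mutually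
  orthogonal, so \<open>\<Sum>\<parallel>u\<^sub>e\<parallel>\<^sup>2 \<le> \<parallel>u\<parallel>\<^sup>2\<close> by Bessel's inequality, and the energy density of \<open>h\<^sub>s\<^sub>,\<^sub>t\<close> is a
  combination of the three \<open>(\<partial>\<^sub>e u)\<^sup>2\<close> with nonnegative coefficients.
\<close>

section \<open>Integrals of periodic functions and Wirtinger's inequality\<close>

text \<open>Translating the cube by \<open>tb\<close> pushes a slab of thickness \<open>t\<close> out on one side; by periodicity it
  is the slab missing on the other side.\<close>

lemma integral_unit_cube_translate_frac:
  fixes F :: "'a::euclidean_space \<Rightarrow> 'b::banach"
  assumes cont: "continuous_on UNIV F" and per: "\<And>x. F (x + b) = F x"
    and b: "b \<in> Basis" and t: "0 \<le> t" "t \<le> (1::real)"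
  shows "integral (cbox 0 One) (\<lambda>x. F (x + t *\<^sub>R b)) = integral (cbox 0 One) F"
proof -
  have cont_shift: "(\<lambda>x. F (x + v)) integrable_on cbox 0 One" for v
    by (intro integrable_continuous continuous_intros continuous_on_compose2[OF cont]) auto
  have low: "cbox (0::'a) One \<inter> {x. x \<bullet> b \<le> s} = cbox 0 (One - (1 - s) *\<^sub>R b)"
    if "0 \<le> s" "s \<le> 1" for s
  proof -
    have "(One - (1 - s) *\<^sub>R b) \<bullet> i = (if i = b then s else 1)" if "i \<in> Basis" for i
      using that b by (simp add: inner_diff_left inner_Basis)
    then have "x \<in> cbox 0 (One - (1 - s) *\<^sub>R b) \<longleftrightarrow>
        (\<forall>i\<in>Basis. 0 \<le> x \<bullet> i \<and> x \<bullet> i \<le> (if i = b then s else 1))" for x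
      unfolding mem_box by (intro ball_cong refl) simp
    moreover have "x \<in> cbox 0 One \<longleftrightarrow> (\<forall>i\<in>Basis. 0 \<le> x \<bullet> i \<and> x \<bullet> i \<le> 1)" for x :: 'a
      unfolding mem_box by simp
    ultimately show ?thesis using that b by (auto split: if_splits; metis order_trans)
  qed
  have high: "cbox (0::'a) One \<inter> {x. x \<bullet> b \<ge> s} = cbox (s *\<^sub>R b) One"
    if "0 \<le> s" "s \<le> 1" for s
  proof -
    have "(s *\<^sub>R b) \<bullet> i = (if i = b then s else 0)" if "i \<in> Basis" for i
      using that b by (simp add: inner_Basis)
    then have "x \<in> cbox (s *\<^sub>R b) One \<longleftrightarrow>
        (\<forall>i\<in>Basis. (if i = b then s else 0) \<le> x \<bullet> i \<and> x \<bullet> i \<le> 1)" for x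
      unfolding mem_box by (intro ball_cong refl) simp
    moreover have "x \<in> cbox 0 One \<longleftrightarrow> (\<forall>i\<in>Basis. 0 \<le> x \<bullet> i \<and> x \<bullet> i \<le> 1)" for x :: 'a
      unfolding mem_box by simp
    ultimately show ?thesis using that b by (auto split: if_splits; metis order_trans)
  qed
  have "integral (cbox 0 One) (\<lambda>x. F (x + t *\<^sub>R b)) =
      integral (cbox 0 (One - t *\<^sub>R b)) (\<lambda>x. F (x + t *\<^sub>R b)) +
      integral (cbox ((1 - t) *\<^sub>R b) One) (\<lambda>x. F (x + t *\<^sub>R b))"
    using integral_split[OF cont_shift[of "t *\<^sub>R b"] b, of "1 - t"] low[of "1 - t"] high[of "1 - t"] t
    by simp
  also have "integral (cbox 0 (One - t *\<^sub>R b)) (\<lambda>x. F (x + t *\<^sub>R b)) = integral (cbox (t *\<^sub>R b) One) F"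
    using integral_shift_cbox[of "t *\<^sub>R b" "t *\<^sub>R b" One F] by simp
  also have "integral (cbox ((1 - t) *\<^sub>R b) One) (\<lambda>x. F (x + t *\<^sub>R b)) =
      integral (cbox 0 (One - (1 - t) *\<^sub>R b)) F"
  proof -
    have "F (x + t *\<^sub>R b) = F (x + (t - 1) *\<^sub>R b)" for x
      using per[of "x + (t - 1) *\<^sub>R b"] by (simp add: algebra_simps)
    then show ?thesis
      using integral_shift_cbox[of 0 "(t - 1) *\<^sub>R b" "One - (1 - t) *\<^sub>R b" F]
      by (simp add: algebra_simps)
  qed
  also have "integral (cbox (t *\<^sub>R b) One) F + integral (cbox 0 (One - (1 - t) *\<^sub>R b)) F =
      integral (cbox 0 One) F"
    using integral_split[OF cont_shift[of 0] b, of t] low[OF t] high[OF t] by simp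
  finally show ?thesis .
qed

lemma periodic_multiple:
  fixes F :: "'a::real_vector \<Rightarrow> 'b"
  assumes "\<And>x. F (x + z) = F x"
  shows "F (x + of_int n *\<^sub>R z) = F x"
proof (induction n rule: int_induct[where k = 0])
  case (step1 i)
  then show ?case using assms[of "x + of_int i *\<^sub>R z"] by (simp add: algebra_simps)
next
  case (step2 i)
  then show ?case using assms[of "x + of_int (i - 1) *\<^sub>R z"] by (simp add: algebra_simps)
qed simp

lemma integral_unit_cube_translate:
  fixes F :: "'a::euclidean_space \<Rightarrow> 'b::banach"
  assumes cont: "continuous_on UNIV F" and per: "\<And>x b. b \<in> Basis \<Longrightarrow> F (x + b) = F x"
  shows "integral (cbox 0 One) (\<lambda>x. F (x + v)) = integral (cbox 0 One) F"
proof -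
  have "integral (cbox 0 One) (\<lambda>x. F (x + (\<Sum>b\<in>B. (v \<bullet> b) *\<^sub>R b))) = integral (cbox 0 One) F"
    if "B \<subseteq> Basis" for B
    using finite_subset[OF that finite_Basis] that
  proof (induction B rule: finite_induct)
    case (insert b B)
    let ?w = "\<Sum>b\<in>B. (v \<bullet> b) *\<^sub>R b"
    let ?G = "\<lambda>x. F (x + ?w)"
    have G: "?G (x + b) = ?G x" for x
      using per[of b "x + ?w"] insert.prems by (simp add: algebra_simps)
    have "F (x + (\<Sum>b\<in>insert b B. (v \<bullet> b) *\<^sub>R b)) = ?G (x + frac (v \<bullet> b) *\<^sub>R b)" for x
    proof -
      have "?G (x + frac (v \<bullet> b) *\<^sub>R b) = ?G (x + frac (v \<bullet> b) *\<^sub>R b + of_int \<lfloor>v \<bullet> b\<rfloor> *\<^sub>R b)"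
        using periodic_multiple[of ?G b, OF G] by simp
      also have "\<dots> = F (x + ?w + (frac (v \<bullet> b) + of_int \<lfloor>v \<bullet> b\<rfloor>) *\<^sub>R b)"
        by (simp add: algebra_simps)
      also have "\<dots> = F (x + (\<Sum>b\<in>insert b B. (v \<bullet> b) *\<^sub>R b))"
        using insert.hyps by (simp add: frac_def algebra_simps)
      finally show ?thesis ..
    qed
    moreover have "integral (cbox 0 One) (\<lambda>x. ?G (x + frac (v \<bullet> b) *\<^sub>R b)) = integral (cbox 0 One) ?G"
      using insert.prems
      by (intro integral_unit_cube_translate_frac G continuous_intros continuous_on_compose2[OF cont])
         (auto simp: frac_ge_0 less_imp_le[OF frac_lt_1])
    ultimately show ?case using insert by simp
  qed simp
  from this[of Basis] show ?thesis by (simp add: euclidean_representation)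
qed

lemma integral_period_translate:
  fixes f :: "real \<Rightarrow> 'b::banach"
  assumes "continuous_on UNIV f" "\<And>t. f (t + 1) = f t"
  shows "integral {0..1} (\<lambda>t. f (t + s)) = integral {0..1} f"
  using integral_unit_cube_translate[of f s] assms by simp

text \<open>Lewy's trick. For \<open>w < 2\<pi>\<close> the function \<open>S(t) = w tan (w (t - q))\<close>, with \<open>q\<close> the midpoint, is
  regular on the closed interval of length \<open>1/2\<close> and solves the Riccati equation \<open>S' = w\<^sup>2 + S\<^sup>2\<close>.
  Therefore \<open>(g' + S g)\<^sup>2 = g'\<^sup>2 - w\<^sup>2 g\<^sup>2 + (S g\<^sup>2)'\<close>, and the boundary term vanishes with \<open>g\<close>. Letting
  \<open>w\<close> tend to \<open>2\<pi>\<close> gives the sharp constant, at which \<open>S\<close> itself would blow up at the end points.\<close>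

lemma half_period_poincare:
  fixes g g' :: "real \<Rightarrow> real"
  assumes der: "\<And>t. (g has_real_derivative g' t) (at t)"
    and cont: "continuous_on UNIV g'"
    and zero: "g p = 0" "g (p + 1/2) = 0"
  shows "4 * pi\<^sup>2 * integral {p..p+1/2} (\<lambda>t. (g t)\<^sup>2) \<le> integral {p..p+1/2} (\<lambda>t. (g' t)\<^sup>2)"
proof -
  have contg: "continuous_on UNIV g"
    by (intro continuous_at_imp_continuous_on ballI DERIV_isCont[OF der])
  have int: "(\<lambda>t. (g t)\<^sup>2) integrable_on {p..p+1/2}" "(\<lambda>t. (g' t)\<^sup>2) integrable_on {p..p+1/2}"
    by (intro integrable_continuous_real continuous_intros
        continuous_on_subset[OF contg] continuous_on_subset[OF cont]; simp)+
  have bound: "w\<^sup>2 * integral {p..p+1/2} (\<lambda>t. (g t)\<^sup>2) \<le> integral {p..p+1/2} (\<lambda>t. (g' t)\<^sup>2)"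
    if w: "0 < w" "w < 2 * pi" for w
  proof -
    define q where "q = p + 1/4"
    have cos0: "cos (w * (t - q)) \<noteq> 0" if "t \<in> {p..p+1/2}" for t
    proof -
      have a: "\<bar>t - q\<bar> \<le> 1/4" using that unfolding q_def atLeastAtMost_iff by linarith
      have "\<bar>w * (t - q)\<bar> = w * \<bar>t - q\<bar>" using w by (simp add: abs_mult)
      also have "\<dots> \<le> w * (1/4)" using a w by (intro mult_left_mono) auto
      also have "\<dots> < pi / 2" using w by simp
      finally have "\<bar>w * (t - q)\<bar> < pi / 2" .
      then have "0 < cos (w * (t - q))" by (intro cos_gt_zero_pi) auto
      then show ?thesis by simp
    qed
    let ?T = "\<lambda>t. tan (w * (t - q))"
    have FTC: "((\<lambda>t. (g' t + w * ?T t * g t)\<^sup>2 - (g' t)\<^sup>2 + w\<^sup>2 * (g t)\<^sup>2) has_integral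
        (g (p+1/2))\<^sup>2 * w * ?T (p+1/2) - (g p)\<^sup>2 * w * ?T p) {p..p+1/2}"
    proof (rule fundamental_theorem_of_calculus)
      fix t assume t: "t \<in> {p..p+1/2}"
      have T': "(?T has_real_derivative (1 + (?T t)\<^sup>2) * w) (at t)"
      proof -
        have "((\<lambda>t. w * (t - q)) has_real_derivative w) (at t)"
          by (auto intro!: derivative_eq_intros)
        from DERIV_chain2[OF DERIV_tan[OF cos0[OF t]] this] show ?thesis
          by (simp only: tan_sec[OF cos0[OF t]] power_inverse)
      qed
      have "((\<lambda>t. (g t)\<^sup>2 * w * ?T t) has_real_derivative
          (2 * g t * g' t * w * ?T t + (1 + (?T t)\<^sup>2) * w * ((g t)\<^sup>2 * w))) (at t)"
        using DERIV_mult[OF DERIV_mult[OF DERIV_power[OF der[of t], of 2] DERIV_const[of w]] T']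
        by (simp add: ac_simps)
      then have "((\<lambda>t. (g t)\<^sup>2 * w * ?T t) has_real_derivative
          ((g' t + w * ?T t * g t)\<^sup>2 - (g' t)\<^sup>2 + w\<^sup>2 * (g t)\<^sup>2)) (at t)"
        by (rule DERIV_cong) (simp add: algebra_simps power2_eq_square)
      then show "((\<lambda>t. (g t)\<^sup>2 * w * ?T t) has_vector_derivative
          ((g' t + w * ?T t * g t)\<^sup>2 - (g' t)\<^sup>2 + w\<^sup>2 * (g t)\<^sup>2)) (at t within {p..p+1/2})"
        by (simp add: has_real_derivative_iff_has_vector_derivative[symmetric] has_field_derivative_at_within)
    qed simp
    then have I0: "((\<lambda>t. (g' t + w * ?T t * g t)\<^sup>2 - (g' t)\<^sup>2 + w\<^sup>2 * (g t)\<^sup>2) has_integral 0) {p..p+1/2}"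
      using zero by simp
    have "((\<lambda>t. w\<^sup>2 * (g t)\<^sup>2 - (g' t)\<^sup>2) has_integral
        (w\<^sup>2 * integral {p..p+1/2} (\<lambda>t. (g t)\<^sup>2) - integral {p..p+1/2} (\<lambda>t. (g' t)\<^sup>2))) {p..p+1/2}"
      by (intro has_integral_diff has_integral_mult_right integrable_integral int)
    from has_integral_le[OF this I0] show ?thesis by simp
  qed
  have "((\<lambda>w. w\<^sup>2 * integral {p..p+1/2} (\<lambda>t. (g t)\<^sup>2)) \<longlongrightarrow> (2 * pi)\<^sup>2 * integral {p..p+1/2} (\<lambda>t. (g t)\<^sup>2))
      (at_left (2 * pi))"
    by (intro tendsto_intros)
  moreover have "\<forall>\<^sub>F w in at_left (2 * pi).
      w\<^sup>2 * integral {p..p+1/2} (\<lambda>t. (g t)\<^sup>2) \<le> integral {p..p+1/2} (\<lambda>t. (g' t)\<^sup>2)"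
    by (rule eventually_mono[OF eventually_at_left_real[of 0 "2 * pi"]]) (auto intro: bound)
  ultimately have "(2 * pi)\<^sup>2 * integral {p..p+1/2} (\<lambda>t. (g t)\<^sup>2) \<le> integral {p..p+1/2} (\<lambda>t. (g' t)\<^sup>2)"
    by (rule tendsto_upperbound) simp
  then show ?thesis by (simp add: power_mult_distrib)
qed

text \<open>By the intermediate value theorem a continuous function of period \<open>1\<close> takes equal values at some
  \<open>p\<close> and \<open>p + 1/2\<close>. Subtracting this common value \<open>m\<close> gives a function vanishing at the ends of both half
  periods, to which \<open>half_period_poincare\<close> applies; and \<open>\<integral> (f - m)\<^sup>2\<close> is at least the variance of \<open>f\<close>.\<close>

lemma wirtinger_inequality:
  fixes f f' :: "real \<Rightarrow> real"
  assumes der: "\<And>t. (f has_real_derivative f' t) (at t)"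
    and cont: "continuous_on UNIV f'"
    and per: "\<And>t. f (t + 1) = f t" "\<And>t. f' (t + 1) = f' t"
  shows "4 * pi\<^sup>2 * (integral {0..1} (\<lambda>t. (f t)\<^sup>2) - (integral {0..1} f)\<^sup>2)
    \<le> integral {0..1} (\<lambda>t. (f' t)\<^sup>2)"
proof -
  have contf: "continuous_on UNIV f"
    by (intro continuous_at_imp_continuous_on ballI DERIV_isCont[OF der])
  have "\<exists>p\<ge>0. p \<le> 1/2 \<and> f (p + 1/2) - f p = 0"
  proof -
    let ?k = "\<lambda>p. f (p + 1/2) - f p"
    have "?k (1/2) = - ?k 0" using per(1)[of 0] by simp
    moreover have "continuous_on {0..1/2} ?k"
      by (intro continuous_intros continuous_on_compose2[OF contf]) auto
    ultimately show ?thesis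
      using IVT'[of ?k 0 0 "1/2"] IVT2'[of ?k "1/2" 0 0]
      by (cases "?k 0 \<le> 0") force+
  qed
  then obtain p where p: "f (p + 1/2) = f p" by auto
  define m where "m = f p"
  let ?g = "\<lambda>t. f t - m"
  have int: "G integrable_on {x..y}" if "continuous_on UNIV G" for G :: "real \<Rightarrow> real" and x y
    using that by (intro integrable_continuous_real) (auto intro: continuous_on_subset)
  have cg: "continuous_on UNIV (\<lambda>t. (?g t)\<^sup>2)" "continuous_on UNIV (\<lambda>t. (f' t)\<^sup>2)"
    by (intro continuous_intros contf cont)+
  have derg: "(?g has_real_derivative f' t) (at t)" for t
    using DERIV_diff[OF der DERIV_const] by simp
  have full: "integral {p..p+1/2} G + integral {p+1/2..p+1/2+1/2} G = integral {0..1} G"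
    if "continuous_on UNIV G" "\<And>t. G (t + 1) = G t" for G :: "real \<Rightarrow> real"
  proof -
    have "integral {p..p+1/2} G + integral {p+1/2..p+1/2+1/2} G = integral {p..p+1/2+1/2} G"
      by (rule Henstock_Kurzweil_Integration.integral_combine) (auto intro: int that)
    also have "\<dots> = integral {0..1} (\<lambda>t. G (t + p))"
      using integral_shift_real_ivl[of p p "p + 1" G] by (simp add: add_ac)
    also have "\<dots> = integral {0..1} G" by (rule integral_period_translate[OF that])
    finally show ?thesis .
  qed
  have half1: "4 * pi\<^sup>2 * integral {p..p+1/2} (\<lambda>t. (?g t)\<^sup>2) \<le> integral {p..p+1/2} (\<lambda>t. (f' t)\<^sup>2)"
    by (rule half_period_poincare[OF derg cont]) (simp_all add: m_def p)
  have half2: "4 * pi\<^sup>2 * integral {p+1/2..p+1/2+1/2} (\<lambda>t. (?g t)\<^sup>2) \<le> integral {p+1/2..p+1/2+1/2} (\<lambda>t. (f' t)\<^sup>2)"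
    by (rule half_period_poincare[OF derg cont]) (use p per(1)[of p] in \<open>simp_all add: m_def add.assoc\<close>)
  have sums: "integral {p..p+1/2} (\<lambda>t. (?g t)\<^sup>2) + integral {p+1/2..p+1/2+1/2} (\<lambda>t. (?g t)\<^sup>2) =
      integral {0..1} (\<lambda>t. (?g t)\<^sup>2)"
    "integral {p..p+1/2} (\<lambda>t. (f' t)\<^sup>2) + integral {p+1/2..p+1/2+1/2} (\<lambda>t. (f' t)\<^sup>2) =
      integral {0..1} (\<lambda>t. (f' t)\<^sup>2)"
    by (intro full cg; simp add: per)+
  have main: "4 * pi\<^sup>2 * integral {0..1} (\<lambda>t. (?g t)\<^sup>2) \<le> integral {0..1} (\<lambda>t. (f' t)\<^sup>2)"
    using add_mono[OF half1 half2] by (simp only: sums flip: distrib_left)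
  have "integral {0..1} (\<lambda>t. (?g t)\<^sup>2) = integral {0..1} (\<lambda>t. (f t)\<^sup>2 - 2 * m * f t + m\<^sup>2)"
    by (simp add: power2_diff algebra_simps)
  also have "\<dots> = integral {0..1} (\<lambda>t. (f t)\<^sup>2) - 2 * m * integral {0..1} f + m\<^sup>2"
    by (subst integral_add integral_diff; (intro int continuous_intros contf)?)+ simp
  also have "\<dots> = integral {0..1} (\<lambda>t. (f t)\<^sup>2) - (integral {0..1} f)\<^sup>2 + (integral {0..1} f - m)\<^sup>2"
    by (simp add: power2_diff algebra_simps)
  finally have "integral {0..1} (\<lambda>t. (f t)\<^sup>2) - (integral {0..1} f)\<^sup>2 \<le> integral {0..1} (\<lambda>t. (?g t)\<^sup>2)"
    by simp
  then have "4 * pi\<^sup>2 * (integral {0..1} (\<lambda>t. (f t)\<^sup>2) - (integral {0..1} f)\<^sup>2) \<le>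
      4 * pi\<^sup>2 * integral {0..1} (\<lambda>t. (?g t)\<^sup>2)"
    by (intro mult_left_mono) auto
  with main show ?thesis by linarith
qed


section \<open>Means over the torus and averages along closed lines\<close>

text \<open>The unit cell has volume \<open>1\<close>, so this is the mean value of a periodic function, and \<open>torus_mean\<close> for
  every nonzero constant density.\<close>

definition mean :: "(real ^ 2 \<Rightarrow> 'b::banach) \<Rightarrow> 'b" where
  "mean f = integral (cbox 0 One) f"

definition cont_periodic :: "(real ^ 2 \<Rightarrow> 'b::topological_space) \<Rightarrow> bool" where
  "cont_periodic f \<longleftrightarrow> continuous_on UNIV f \<and> periodic f"

lemma cont_periodicI:
  "continuous_on UNIV f \<Longrightarrow> (\<And>x z. z \<in> lattice \<Longrightarrow> f (x + z) = f x) \<Longrightarrow> cont_periodic f"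
  by (simp add: cont_periodic_def periodic_def)

lemma cont_periodicD:
  assumes "cont_periodic f"
  shows "continuous_on UNIV f" "\<And>x z. z \<in> lattice \<Longrightarrow> f (x + z) = f x"
  using assms by (auto simp: cont_periodic_def periodic_def)

lemma cont_periodic_integrable:
  fixes f :: "real ^ 2 \<Rightarrow> 'b::banach"
  shows "cont_periodic f \<Longrightarrow> f integrable_on cbox 0 One"
  by (intro integrable_continuous) (auto simp: cont_periodic_def intro: continuous_on_subset)

lemma cont_periodic_const [simp, intro]: "cont_periodic (\<lambda>_. c)"
  by (simp add: cont_periodic_def periodic_def)

lemma cont_periodic_add [simp, intro]:
  fixes f g :: "real ^ 2 \<Rightarrow> 'b::real_normed_vector"
  shows "cont_periodic f \<Longrightarrow> cont_periodic g \<Longrightarrow> cont_periodic (\<lambda>x. f x + g x)"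
  by (simp add: cont_periodic_def periodic_def continuous_on_add)

lemma cont_periodic_diff [simp, intro]:
  fixes f g :: "real ^ 2 \<Rightarrow> 'b::real_normed_vector"
  shows "cont_periodic f \<Longrightarrow> cont_periodic g \<Longrightarrow> cont_periodic (\<lambda>x. f x - g x)"
  by (simp add: cont_periodic_def periodic_def continuous_on_diff)

lemma cont_periodic_mult [simp, intro]:
  fixes f g :: "real ^ 2 \<Rightarrow> real"
  shows "cont_periodic f \<Longrightarrow> cont_periodic g \<Longrightarrow> cont_periodic (\<lambda>x. f x * g x)"
  by (simp add: cont_periodic_def periodic_def continuous_on_mult)

lemma cont_periodic_power [simp, intro]:
  fixes f :: "real ^ 2 \<Rightarrow> real"
  shows "cont_periodic f \<Longrightarrow> cont_periodic (\<lambda>x. (f x) ^ n)"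
  by (simp add: cont_periodic_def periodic_def continuous_on_power)

lemma cont_periodic_sum [simp, intro]:
  fixes f :: "'i \<Rightarrow> real ^ 2 \<Rightarrow> 'b::real_normed_vector"
  shows "(\<And>i. i \<in> I \<Longrightarrow> cont_periodic (f i)) \<Longrightarrow> cont_periodic (\<lambda>x. \<Sum>i\<in>I. f i x)"
  by (simp add: cont_periodic_def periodic_def continuous_on_sum)

lemma mean_add: "cont_periodic f \<Longrightarrow> cont_periodic g \<Longrightarrow> mean (\<lambda>x. f x + g x) = mean f + mean g"
  unfolding mean_def by (intro integral_add cont_periodic_integrable)

lemma mean_diff: "cont_periodic f \<Longrightarrow> cont_periodic g \<Longrightarrow> mean (\<lambda>x. f x - g x) = mean f - mean g"
  unfolding mean_def by (intro integral_diff cont_periodic_integrable)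

lemma mean_mult_left: "mean (\<lambda>x. c * f x) = c * (mean f :: real)"
  by (simp add: mean_def)

lemma mean_sum:
  "finite I \<Longrightarrow> (\<And>i. i \<in> I \<Longrightarrow> cont_periodic (f i)) \<Longrightarrow> mean (\<lambda>x. \<Sum>i\<in>I. f i x) = (\<Sum>i\<in>I. mean (f i))"
  unfolding mean_def by (intro integral_sum cont_periodic_integrable)

lemma measure_unit_cube: "measure lborel (cbox (0::'a::euclidean_space) One) = 1"
  by (subst content_cbox) (auto intro!: prod.neutral)

lemma mean_const: "mean (\<lambda>_. c) = c"
  by (simp add: mean_def measure_unit_cube del: content_cbox_if)

lemma mean_mono:
  fixes f g :: "real ^ 2 \<Rightarrow> real"
  shows "cont_periodic f \<Longrightarrow> cont_periodic g \<Longrightarrow> (\<And>x. f x \<le> g x) \<Longrightarrow> mean f \<le> mean g"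
  unfolding mean_def by (intro integral_le cont_periodic_integrable)

lemma mean_nonneg:
  fixes f :: "real ^ 2 \<Rightarrow> real"
  shows "(\<And>x. 0 \<le> f x) \<Longrightarrow> 0 \<le> mean f"
  unfolding mean_def by (cases "f integrable_on cbox 0 One") (auto intro: integral_nonneg simp: not_integrable_integral)

lemma Basis_in_lattice: "b \<in> Basis \<Longrightarrow> b \<in> lattice"
  by (auto simp: lattice_def Basis_vec_def axis_def)

lemma floor_in_lattice: "(\<chi> i. of_int \<lfloor>(x :: real ^ 2) $ i\<rfloor>) \<in> lattice"
  by (simp add: lattice_def)

lemma One_vec_eq: "(One :: real ^ 'n) = (\<chi> i. 1)"
proof (rule euclidean_eqI)
  fix b :: "real ^ 'n" assume b: "b \<in> Basis"
  then show "One \<bullet> b = (\<chi> i. 1) \<bullet> b"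
    using inner_sum_left_Basis[OF b, of "\<lambda>_. 1"] by (auto simp: Basis_vec_def inner_axis)
qed

lemma mean_translate:
  "cont_periodic f \<Longrightarrow> mean (\<lambda>x. f (x + v)) = mean f"
  unfolding mean_def
  by (intro integral_unit_cube_translate) (auto intro: cont_periodicD Basis_in_lattice)

text \<open>Definiteness: each point is moved into the unit cell by subtracting the integer parts of its
  coordinates.\<close>

lemma mean_square_eq_0:
  fixes f :: "real ^ 2 \<Rightarrow> real"
  assumes f: "cont_periodic f" and 0: "mean (\<lambda>x. (f x)\<^sup>2) = 0"
  shows "f = (\<lambda>_. 0)"
proof
  fix x :: "real ^ 2"
  let ?z = "(\<chi> i. of_int \<lfloor>x $ i\<rfloor>) :: real ^ 2"
  have I: "((\<lambda>x. (f x)\<^sup>2) has_integral 0) (cbox 0 One)"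
    using cont_periodic_integrable[OF cont_periodic_power[OF f]] 0 unfolding mean_def
    by (metis integrable_integral)
  have cell: "x - ?z \<in> cbox 0 One"
    by (auto simp: One_vec_eq mem_box_cart less_imp_le frac_lt_1 simp flip: frac_def)
  have "(f (x - ?z))\<^sup>2 = 0"
    by (rule has_integral_0_cbox_imp_0[OF _ _ I _ cell])
       (auto intro!: continuous_intros continuous_on_subset[OF cont_periodicD(1)[OF f]])
  then show "f x = 0"
    using cont_periodicD(2)[OF f floor_in_lattice, of "x - ?z" x] by simp
qed

lemma mean_square_pos:
  fixes f :: "real ^ 2 \<Rightarrow> real"
  assumes "cont_periodic f" "f \<noteq> (\<lambda>_. 0)"
  shows "0 < mean (\<lambda>x. (f x)\<^sup>2)"
  using mean_square_eq_0[OF assms(1)] assms(2) mean_nonneg[of "\<lambda>x. (f x)\<^sup>2"]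
  by (metis order_le_less zero_le_power2)

lemma mean_line_swap:
  fixes F :: "real ^ 2 \<Rightarrow> real \<Rightarrow> 'b::banach"
  assumes "continuous_on UNIV (\<lambda>(x, t). F x t)"
  shows "mean (\<lambda>x. integral {0..1} (F x)) = integral {0..1} (\<lambda>t. mean (\<lambda>x. F x t))"
  unfolding mean_def using integral_swap_continuous[of 0 0 One 1 F] assms
  by (simp add: continuous_on_subset)

definition line_avg :: "real ^ 2 \<Rightarrow> (real ^ 2 \<Rightarrow> real) \<Rightarrow> real ^ 2 \<Rightarrow> real" where
  "line_avg e u x = integral {0..1} (\<lambda>t. u (x + t *\<^sub>R e))"

lemma cont_periodic_line_avg [simp, intro]:
  assumes u: "cont_periodic u"
  shows "cont_periodic (line_avg e u)"
proof (rule cont_periodicI)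
  have "continuous_on UNIV (\<lambda>x. integral (cbox 0 1) (\<lambda>t. u (x + t *\<^sub>R e)))"
    by (rule integral_continuous_on_param)
       (auto intro!: continuous_intros continuous_on_compose2[OF cont_periodicD(1)[OF u]] simp: case_prod_unfold)
  then show "continuous_on UNIV (line_avg e u)" by (simp add: line_avg_def[abs_def])
  fix x z :: "real ^ 2" assume "z \<in> lattice"
  then show "line_avg e u (x + z) = line_avg e u x"
    using cont_periodicD(2)[OF u, of z "x + t *\<^sub>R e" for t] by (simp add: line_avg_def algebra_simps)
qed

lemma line_avg_translate:
  assumes u: "cont_periodic u" and e: "e \<in> lattice"
  shows "line_avg e u (x + s *\<^sub>R e) = line_avg e u x"
proof -
  have "integral {0..1} (\<lambda>t. u (x + (t + s) *\<^sub>R e)) = integral {0..1} (\<lambda>t. u (x + t *\<^sub>R e))"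
  proof (rule integral_period_translate)
    show "continuous_on UNIV (\<lambda>t. u (x + t *\<^sub>R e))"
      by (intro continuous_intros continuous_on_compose2[OF cont_periodicD(1)[OF u]]) auto
    show "u (x + (t + 1) *\<^sub>R e) = u (x + t *\<^sub>R e)" for t
      using cont_periodicD(2)[OF u e, of "x + t *\<^sub>R e"] by (simp add: algebra_simps)
  qed
  then show ?thesis by (simp add: line_avg_def algebra_simps)
qed

text \<open>Averaging along lines is self-adjoint: a factor that is constant along the lines of direction \<open>e\<close>
  cannot distinguish \<open>u\<close> from its average over them.\<close>

lemma mean_mult_line_invariant:
  assumes u: "cont_periodic u" and w: "cont_periodic w"
    and inv: "\<And>x s. w (x + s *\<^sub>R e) = w x"
  shows "mean (\<lambda>x. line_avg e u x * w x) = mean (\<lambda>x. u x * w x)"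
proof -
  have "mean (\<lambda>x. line_avg e u x * w x) = mean (\<lambda>x. integral {0..1} (\<lambda>t. u (x + t *\<^sub>R e) * w x))"
    by (simp add: line_avg_def)
  also have "\<dots> = integral {0..1} (\<lambda>t. mean (\<lambda>x. u (x + t *\<^sub>R e) * w x))"
    by (rule mean_line_swap)
       (auto intro!: continuous_intros continuous_on_compose2[OF cont_periodicD(1)[OF u]]
         continuous_on_compose2[OF cont_periodicD(1)[OF w]] simp: case_prod_unfold)
  also have "\<dots> = integral {0..1} (\<lambda>t::real. mean (\<lambda>x. u x * w x))"
  proof (rule integral_cong)
    fix t
    show "mean (\<lambda>x. u (x + t *\<^sub>R e) * w x) = mean (\<lambda>x. u x * w x)"
      using mean_translate[OF cont_periodic_mult[OF u w], of "t *\<^sub>R e"] by (simp add: inv)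
  qed
  finally show ?thesis by simp
qed

text \<open>The double average is invariant under translation in both directions, hence constant; its value is
  its mean, which is the mean of \<open>u\<close>. This replaces a change of variables to the coordinates given
  by \<open>e\<close> and \<open>f\<close>.\<close>

lemma line_avg_line_avg:
  assumes u: "cont_periodic u" and e: "e \<in> lattice" and f: "f \<in> lattice"
    and span: "\<And>x. \<exists>s t. x = s *\<^sub>R e + t *\<^sub>R f"
  shows "line_avg e (line_avg f u) x = mean u"
proof -
  let ?q = "line_avg e (line_avg f u)"
  have q: "cont_periodic ?q" using u by blast
  have "?q y = ?q 0" for y
  proof -
    obtain s t where y: "y = s *\<^sub>R e + t *\<^sub>R f" using span by blast
    have "?q (t *\<^sub>R f + s *\<^sub>R e) = ?q (0 + t *\<^sub>R f)"
      using line_avg_translate[OF cont_periodic_line_avg[OF u] e] by simp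
    also have "\<dots> = ?q 0"
      using line_avg_translate[OF u f, of "r *\<^sub>R e" t for r] by (simp add: line_avg_def[of e] add.commute)
    finally show ?thesis by (simp add: y add.commute)
  qed
  moreover have "mean ?q = mean u"
    using mean_mult_line_invariant[OF cont_periodic_line_avg[OF u] cont_periodic_const[of 1], of e f]
      mean_mult_line_invariant[OF u cont_periodic_const[of 1], of f] by simp
  ultimately show ?thesis by (metis mean_const ext)
qed

text \<open>By self-adjointness the inner product is that of \<open>u\<^sub>e\<close> with the double average, which is the constant
  \<open>0\<close>.\<close>

lemma line_avg_orthogonal:
  assumes u: "cont_periodic u" and e: "e \<in> lattice" and f: "f \<in> lattice"
    and span: "\<And>x. \<exists>s t. x = s *\<^sub>R e + t *\<^sub>R f" and 0: "mean u = 0"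
  shows "mean (\<lambda>x. line_avg e u x * line_avg f u x) = 0"
proof -
  have "mean (\<lambda>x. line_avg f u x * line_avg e u x) = mean (\<lambda>x. line_avg e (line_avg f u) x * line_avg e u x)"
    using u e by (intro mean_mult_line_invariant[symmetric]) (auto simp: line_avg_translate)
  then show ?thesis by (simp add: line_avg_line_avg[OF u e f span] 0 mult.commute mean_const)
qed

text \<open>Bessel's inequality: the averages are the orthogonal projections of \<open>u\<close> to mutually orthogonal
  subspaces, so expanding \<open>0 \<le> \<parallel>u - \<Sum>\<^sub>e u\<^sub>e\<parallel>\<^sup>2\<close> leaves \<open>\<parallel>u\<parallel>\<^sup>2 - \<Sum>\<^sub>e \<parallel>u\<^sub>e\<parallel>\<^sup>2\<close>.\<close>

lemma line_avg_bessel: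
  assumes u: "cont_periodic u" and 0: "mean u = 0" and I: "finite I" "I \<subseteq> lattice"
    and span: "\<And>e f x. e \<in> I \<Longrightarrow> f \<in> I \<Longrightarrow> e \<noteq> f \<Longrightarrow> \<exists>s t. x = s *\<^sub>R e + t *\<^sub>R f"
  shows "(\<Sum>e\<in>I. mean (\<lambda>x. (line_avg e u x)\<^sup>2)) \<le> mean (\<lambda>x. (u x)\<^sup>2)"
proof -
  let ?A = "\<lambda>e. line_avg e u" and ?S = "\<lambda>x. \<Sum>e\<in>I. line_avg e u x"
  note cp = u cont_periodic_line_avg[OF u]
  have diag: "mean (\<lambda>x. u x * ?A e x) = mean (\<lambda>x. (?A e x)\<^sup>2)" if "e \<in> I" for e
    using mean_mult_line_invariant[OF u cont_periodic_line_avg[OF u], of e e]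
      line_avg_translate[OF u] that I by (auto simp: power2_eq_square)
  have uS: "mean (\<lambda>x. u x * ?S x) = (\<Sum>e\<in>I. mean (\<lambda>x. (?A e x)\<^sup>2))"
    unfolding sum_distrib_left using I(1) diag cp
    by (subst mean_sum) auto
  have "mean (\<lambda>x. ?S x * ?S x) = (\<Sum>e\<in>I. \<Sum>f\<in>I. mean (\<lambda>x. ?A e x * ?A f x))"
    unfolding sum_product using I(1) cp
    by (simp add: mean_sum)
  also have "\<dots> = (\<Sum>e\<in>I. \<Sum>f\<in>I. if f = e then mean (\<lambda>x. (?A e x)\<^sup>2) else 0)"
  proof (intro sum.cong refl)
    fix e f assume ef: "e \<in> I" "f \<in> I"
    show "mean (\<lambda>x. ?A e x * ?A f x) = (if f = e then mean (\<lambda>x. (?A e x)\<^sup>2) else 0)"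
    proof (cases "f = e")
      case False
      then show ?thesis using line_avg_orthogonal[OF u _ _ span 0, of e f] ef I by auto
    qed (simp add: power2_eq_square)
  qed
  also have "\<dots> = (\<Sum>e\<in>I. mean (\<lambda>x. (?A e x)\<^sup>2))" using I(1) by (simp add: sum.delta)
  finally have SS: "mean (\<lambda>x. ?S x * ?S x) = (\<Sum>e\<in>I. mean (\<lambda>x. (?A e x)\<^sup>2))" .
  have "0 \<le> mean (\<lambda>x. (u x - ?S x)\<^sup>2)" by (rule mean_nonneg) simp
  also have "(\<lambda>x. (u x - ?S x)\<^sup>2) = (\<lambda>x. (u x)\<^sup>2 - 2 * (u x * ?S x) + ?S x * ?S x)"
    by (simp add: power2_eq_square algebra_simps)
  also have "mean \<dots> = mean (\<lambda>x. (u x)\<^sup>2) - 2 * mean (\<lambda>x. u x * ?S x) + mean (\<lambda>x. ?S x * ?S x)"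
    using cp by (simp add: mean_add mean_diff mean_mult_left)
  finally show ?thesis using uS SS by simp
qed


section \<open>The sharp Poincare inequality\<close>

definition C1_periodic :: "(real ^ 2 \<Rightarrow> 'b::real_normed_vector) \<Rightarrow> bool" where
  "C1_periodic u \<longleftrightarrow> C_k 1 u \<and> periodic u"

lemma C1_periodic_differentiable:
  assumes "C1_periodic u"
  shows "(u has_derivative frechet_derivative u (at x)) (at x)"
  using assms by (simp add: C1_periodic_def flip: frechet_derivative_works)

lemma C1_periodic_cont_periodic [simp]:
  assumes u: "C1_periodic u"
  shows "cont_periodic u"
  unfolding cont_periodic_def
proof
  show "continuous_on UNIV u"
    using C1_periodic_differentiable[OF u]
    by (intro continuous_at_imp_continuous_on ballI has_derivative_continuous)
  show "periodic u" using u by (simp add: C1_periodic_def)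
qed

lemma frechet_derivative_translate:
  assumes u: "u differentiable at (x + z)" and per: "\<And>y. u (y + z) = u y"
  shows "frechet_derivative u (at (x + z)) = frechet_derivative u (at x)"
proof -
  have "((\<lambda>y. y + z) has_derivative (\<lambda>v. v)) (at x)"
    by (auto intro!: derivative_eq_intros)
  then have "((\<lambda>y. u (y + z)) has_derivative (\<lambda>v. frechet_derivative u (at (x + z)) v)) (at x)"
    using has_derivative_compose[of "\<lambda>y. y + z", OF _ u[unfolded frechet_derivative_works]] by simp
  then show ?thesis by (simp add: per frechet_derivative_at[symmetric])
qed

lemma C1_periodic_derivative [simp]:
  assumes u: "C1_periodic u"
  shows "cont_periodic (\<lambda>x. frechet_derivative u (at x) v)"
  using u unfolding C1_periodic_def cont_periodic_def
  by (auto simp: periodic_def frechet_derivative_translate)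

lemma C1_periodic_line_derivative:
  fixes u :: "real ^ 2 \<Rightarrow> real"
  assumes u: "C1_periodic u"
  shows "((\<lambda>t. u (x + t *\<^sub>R e)) has_real_derivative frechet_derivative u (at (x + t *\<^sub>R e)) e) (at t)"
proof -
  have D: "(u has_derivative frechet_derivative u (at (x + t *\<^sub>R e))) (at (x + t *\<^sub>R e))"
    by (rule C1_periodic_differentiable[OF u])
  have "((\<lambda>t. x + t *\<^sub>R e) has_derivative (\<lambda>s. s *\<^sub>R e)) (at t)"
    by (auto intro!: derivative_eq_intros)
  from has_derivative_compose[OF this D] show ?thesis
    by (simp add: has_field_derivative_def linear_cmul[OF has_derivative_linear[OF D]] mult_commute_abs)
qed

text \<open>Since \<open>e\<close> is a lattice vector, \<open>u\<close> has period \<open>1\<close> along every line of direction \<open>e\<close>; Wirtinger's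
  inequality holds on each of these lines and is then integrated over their starting points.\<close>

lemma directional_wirtinger:
  fixes u :: "real ^ 2 \<Rightarrow> real"
  assumes u: "C1_periodic u" and e: "e \<in> lattice"
  shows "4 * pi\<^sup>2 * (mean (\<lambda>x. (u x)\<^sup>2) - mean (\<lambda>x. (line_avg e u x)\<^sup>2))
    \<le> mean (\<lambda>x. (frechet_derivative u (at x) e)\<^sup>2)"
proof -
  let ?D = "\<lambda>x. frechet_derivative u (at x) e"
  have cp: "cont_periodic u" "cont_periodic ?D" using u by auto
  have line: "4 * pi\<^sup>2 * (line_avg e (\<lambda>x. (u x)\<^sup>2) x - (line_avg e u x)\<^sup>2) \<le> line_avg e (\<lambda>x. (?D x)\<^sup>2) x" for x
    unfolding line_avg_def
  proof (rule wirtinger_inequality)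
    show "((\<lambda>t. u (x + t *\<^sub>R e)) has_real_derivative ?D (x + t *\<^sub>R e)) (at t)" for t
      by (rule C1_periodic_line_derivative[OF u])
    show "continuous_on UNIV (\<lambda>t. ?D (x + t *\<^sub>R e))"
      by (intro continuous_intros continuous_on_compose2[OF cont_periodicD(1)[OF cp(2)]]) auto
    show "u (x + (t + 1) *\<^sub>R e) = u (x + t *\<^sub>R e)" "?D (x + (t + 1) *\<^sub>R e) = ?D (x + t *\<^sub>R e)" for t
      using cp[THEN cont_periodicD(2), OF e, of "x + t *\<^sub>R e"] by (simp_all add: algebra_simps)
  qed
  have mean_line: "mean (line_avg e w) = mean w" if "cont_periodic w" for w
    using mean_mult_line_invariant[OF that cont_periodic_const[of 1]] by simp
  have "mean (\<lambda>x. 4 * pi\<^sup>2 * (line_avg e (\<lambda>x. (u x)\<^sup>2) x - (line_avg e u x)\<^sup>2))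
      \<le> mean (line_avg e (\<lambda>x. (?D x)\<^sup>2))"
    by (rule mean_mono[OF _ _ line]) (use cp in auto)
  then show ?thesis using cp by (simp add: mean_mult_left mean_diff mean_line)
qed

lemma cont_periodic_translate:
  assumes u: "cont_periodic u"
  shows "cont_periodic (\<lambda>x. u (x + v))"
proof (rule cont_periodicI)
  show "continuous_on UNIV (\<lambda>x. u (x + v))"
    by (intro continuous_intros continuous_on_compose2[OF cont_periodicD(1)[OF u]]) auto
  show "u (x + z + v) = u (x + v)" if "z \<in> lattice" for x z
    using cont_periodicD(2)[OF u that, of "x + v"] by (simp add: algebra_simps)
qed

text \<open>The average of \<open>\<partial>\<^sub>e u\<close> over the segment from \<open>x\<close> to \<open>x + e\<close> is \<open>u(x + e) - u(x)\<close>, whose mean is \<open>0\<close> by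
  translation invariance.\<close>

lemma mean_derivative:
  fixes u :: "real ^ 2 \<Rightarrow> real"
  assumes u: "C1_periodic u"
  shows "mean (\<lambda>x. frechet_derivative u (at x) e) = 0"
proof -
  let ?D = "\<lambda>x. frechet_derivative u (at x) e"
  have cp: "cont_periodic u" "cont_periodic ?D" using u by auto
  have "line_avg e ?D x = u (x + e) - u x" for x
  proof -
    have "((\<lambda>t. ?D (x + t *\<^sub>R e)) has_integral u (x + 1 *\<^sub>R e) - u (x + 0 *\<^sub>R e)) {0..1}"
    proof (rule fundamental_theorem_of_calculus)
      show "((\<lambda>t. u (x + t *\<^sub>R e)) has_vector_derivative ?D (x + t *\<^sub>R e)) (at t within {0..1})" for t
        using has_field_derivative_at_within[OF C1_periodic_line_derivative[OF u]]
        by (simp add: has_real_derivative_iff_has_vector_derivative)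
    qed simp
    then show ?thesis by (simp add: line_avg_def integral_unique)
  qed
  then have "mean (line_avg e ?D) = mean (\<lambda>x. u (x + e) - u x)" by presburger
  also have "\<dots> = mean (\<lambda>x. u (x + e)) - mean u"
    by (intro mean_diff cont_periodic_translate cp)
  also have "\<dots> = 0" using mean_translate[OF cp(1)] by simp
  finally show ?thesis
    using mean_mult_line_invariant[OF cp(2) cont_periodic_const[of 1], of e] by simp
qed

lemma frechet_derivative_mult:
  fixes u w :: "real ^ 2 \<Rightarrow> real"
  assumes "u differentiable at x" "w differentiable at x"
  shows "frechet_derivative (\<lambda>x. u x * w x) (at x) =
    (\<lambda>v. u x * frechet_derivative w (at x) v + frechet_derivative u (at x) v * w x)"
  using assms unfolding frechet_derivative_works
  by (intro frechet_derivative_at[symmetric] has_derivative_mult)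

lemma C1_periodic_mult:
  fixes u w :: "real ^ 2 \<Rightarrow> real"
  assumes u: "C1_periodic u" and w: "C1_periodic w"
  shows "C1_periodic (\<lambda>x. u x * w x)"
proof -
  have "frechet_derivative (\<lambda>x. u x * w x) (at x) =
      (\<lambda>v. u x * frechet_derivative w (at x) v + frechet_derivative u (at x) v * w x)" for x
    using u w by (intro frechet_derivative_mult) (auto simp: C1_periodic_def)
  then have "continuous_on UNIV (\<lambda>x. frechet_derivative (\<lambda>x. u x * w x) (at x) v)" for v
    using u w by (auto intro!: continuous_intros cont_periodicD(1))
  then show ?thesis using u w unfolding C1_periodic_def periodic_def by simp
qed

lemma mean_integration_by_parts:
  fixes u w :: "real ^ 2 \<Rightarrow> real"
  assumes u: "C1_periodic u" and w: "C1_periodic w"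
  shows "mean (\<lambda>x. u x * frechet_derivative w (at x) e) = - mean (\<lambda>x. frechet_derivative u (at x) e * w x)"
proof -
  have "mean (\<lambda>x. u x * frechet_derivative w (at x) e + frechet_derivative u (at x) e * w x) = 0"
    using mean_derivative[OF C1_periodic_mult[OF u w], of e] frechet_derivative_mult[of u _ w] u w
    by (simp add: C1_periodic_def)
  then show ?thesis using u w by (simp add: mean_add)
qed

text \<open>For \<open>s\<^sup>2 + t\<^sup>2 = 1\<close> and \<open>t \<noteq> 0\<close> this is \<open>t\<^sup>2\<close> times the quadratic form of the dual metric of \<open>h\<^sub>s\<^sub>,\<^sub>t\<close>.\<close>

definition hex_form :: "real \<Rightarrow> real ^ 2 \<Rightarrow> real" where
  "hex_form s \<xi> = (\<xi> $ 1)\<^sup>2 - 2 * s * \<xi> $ 1 * \<xi> $ 2 + (\<xi> $ 2)\<^sup>2"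

lemma spanning_pair:
  fixes e f x :: "real ^ 2"
  assumes "e $ 1 * f $ 2 - e $ 2 * f $ 1 \<noteq> 0"
  shows "\<exists>p q. x = p *\<^sub>R e + q *\<^sub>R f"
proof -
  let ?d = "e $ 1 * f $ 2 - e $ 2 * f $ 1"
  have "x = ((x $ 1 * f $ 2 - x $ 2 * f $ 1) / ?d) *\<^sub>R e + ((e $ 1 * x $ 2 - e $ 2 * x $ 1) / ?d) *\<^sub>R f"
    using assms by (simp add: vec_eq_iff forall_2 divide_simps) (simp add: algebra_simps)
  then show ?thesis by blast
qed

text \<open>The form splits as \<open>(1 - s) (\<xi>\<^sub>1\<^sup>2 + \<xi>\<^sub>2\<^sup>2) + s (\<xi>\<^sub>1 - \<xi>\<^sub>2)\<^sup>2\<close>, a combination of squared derivatives in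
  the lattice directions \<open>e\<^sub>1\<close>, \<open>e\<^sub>2\<close>, \<open>e\<^sub>1 - e\<^sub>2\<close>. With \<open>N = \<parallel>u\<parallel>\<^sup>2\<close> and \<open>P\<^sub>e = \<parallel>u\<^sub>e\<parallel>\<^sup>2\<close>, Wirtinger's
  inequality leaves \<open>(2 - s) N - (1 - s) (P\<^sub>1 + P\<^sub>2) - s P\<^sub>3\<close> to be bounded below by \<open>N\<close>; as
  \<open>s \<le> 1 - s\<close>, this is Bessel's inequality \<open>P\<^sub>1 + P\<^sub>2 + P\<^sub>3 \<le> N\<close>.\<close>

lemma torus_poincare:
  fixes u :: "real ^ 2 \<Rightarrow> real"
  assumes s: "0 \<le> s" "s \<le> 1/2" and u: "C1_periodic u" and 0: "mean u = 0"
  shows "4 * pi\<^sup>2 * mean (\<lambda>x. (u x)\<^sup>2) \<le> mean (\<lambda>x. hex_form s (differential u x))"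
proof -
  define e1 e2 :: "real ^ 2" where "e1 = axis 1 1" and "e2 = axis 2 1"
  let ?D = "\<lambda>v x. frechet_derivative u (at x) v"
  let ?N = "mean (\<lambda>x. (u x)\<^sup>2)" and ?P = "\<lambda>e. mean (\<lambda>x. (line_avg e u x)\<^sup>2)"
  let ?E = "\<lambda>e. mean (\<lambda>x. (?D e x)\<^sup>2)"
  have cp: "cont_periodic u" "\<And>v. cont_periodic (?D v)" using u by auto
  have comp: "e1 $ 1 = 1" "e1 $ 2 = 0" "e2 $ 1 = 0" "e2 $ 2 = 1"
    by (auto simp: e1_def e2_def axis_def)
  have lat: "e1 \<in> lattice" "e2 \<in> lattice" "e1 - e2 \<in> lattice"
    by (auto simp: lattice_def forall_2 comp)
  have dist: "e1 \<noteq> e2" "e1 \<noteq> e1 - e2" "e2 \<noteq> e1 - e2"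
    by (auto simp: vec_eq_iff forall_2 comp)
  have span: "\<exists>p q. x = p *\<^sub>R e + q *\<^sub>R f"
    if "e \<in> {e1, e2, e1 - e2}" "f \<in> {e1, e2, e1 - e2}" "e \<noteq> f" for e f x
  proof (rule spanning_pair)
    show "e $ 1 * f $ 2 - e $ 2 * f $ 1 \<noteq> 0" using that by (auto simp: comp)
  qed
  have "(\<Sum>e\<in>{e1, e2, e1 - e2}. ?P e) \<le> ?N"
    by (rule line_avg_bessel[OF cp(1) 0]) (use lat span in auto)
  then have bessel: "?P e1 + ?P e2 + ?P (e1 - e2) \<le> ?N"
    using dist by simp
  have P0: "0 \<le> ?P e" for e by (rule mean_nonneg) simp
  have D12: "?D (e1 - e2) x = ?D e1 x - ?D e2 x" for x
    by (rule linear_diff[OF has_derivative_linear[OF C1_periodic_differentiable[OF u]]])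
  have "hex_form s (differential u x) = (1 - s) * ((?D e1 x)\<^sup>2 + (?D e2 x)\<^sup>2) + s * (?D (e1 - e2) x)\<^sup>2" for x
    by (simp add: hex_form_def differential_def partial_def D12 e1_def[symmetric] e2_def[symmetric]
        power2_eq_square algebra_simps)
  then have E: "mean (\<lambda>x. hex_form s (differential u x)) = (1 - s) * (?E e1 + ?E e2) + s * ?E (e1 - e2)"
    using cp by (simp add: mean_add mean_mult_left)
  have w: "4 * pi\<^sup>2 * (?N - ?P e) \<le> ?E e" if "e \<in> lattice" for e
    by (rule directional_wirtinger[OF u that])
  have "?N \<le> (1 - s) * ((?N - ?P e1) + (?N - ?P e2)) + s * (?N - ?P (e1 - e2))"
  proof -
    have "(1 - s) * (?P e1 + ?P e2) + s * ?P (e1 - e2) \<le> (1 - s) * (?P e1 + ?P e2 + ?P (e1 - e2))"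
      using mult_right_mono[of s "1 - s" "?P (e1 - e2)"] s P0 by (simp add: algebra_simps)
    also have "\<dots> \<le> (1 - s) * ?N" using s bessel by (intro mult_left_mono) auto
    finally show ?thesis by (simp add: algebra_simps)
  qed
  then have "4 * pi\<^sup>2 * ?N \<le> 4 * pi\<^sup>2 * ((1 - s) * ((?N - ?P e1) + (?N - ?P e2)) + s * (?N - ?P (e1 - e2)))"
    by (intro mult_left_mono) auto
  also have "\<dots> = (1 - s) * (4 * pi\<^sup>2 * (?N - ?P e1) + 4 * pi\<^sup>2 * (?N - ?P e2)) + s * (4 * pi\<^sup>2 * (?N - ?P (e1 - e2)))"
    by (simp add: algebra_simps)
  also have "\<dots> \<le> (1 - s) * (?E e1 + ?E e2) + s * ?E (e1 - e2)"
    using s w lat by (intro add_mono mult_left_mono) auto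
  finally show ?thesis by (simp add: E)
qed


section \<open>Smooth maps and plane waves\<close>

lemma C_k_bounded_linear:
  assumes L: "bounded_linear L" and f: "C_k k f"
  shows "C_k k (\<lambda>x. L (f x))"
  using f
proof (induction k arbitrary: f)
  case 0
  then show ?case using bounded_linear.continuous_on[OF L] by simp
next
  case (Suc k)
  have D: "((\<lambda>x. L (f x)) has_derivative (\<lambda>v. L (frechet_derivative f (at x) v))) (at x)" for x
    using Suc.prems by (intro bounded_linear.has_derivative[OF L]) (simp flip: frechet_derivative_works)
  have "frechet_derivative (\<lambda>x. L (f x)) (at x) = (\<lambda>v. L (frechet_derivative f (at x) v))" for x
    using frechet_derivative_at[OF D] by simp
  then show ?case using Suc differentiableI[OF D] by simp
qed

lemma C_k_add:
  assumes "C_k k f" "C_k k g"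
  shows "C_k k (\<lambda>x. f x + g x)"
  using assms
proof (induction k arbitrary: f g)
  case (Suc k)
  have D: "((\<lambda>x. f x + g x) has_derivative
      (\<lambda>v. frechet_derivative f (at x) v + frechet_derivative g (at x) v)) (at x)" for x
    using Suc.prems by (intro has_derivative_add) (simp_all flip: frechet_derivative_works)
  have "frechet_derivative (\<lambda>x. f x + g x) (at x) =
      (\<lambda>v. frechet_derivative f (at x) v + frechet_derivative g (at x) v)" for x
    using frechet_derivative_at[OF D] by simp
  then show ?case using Suc differentiableI[OF D] by simp
qed (auto intro: continuous_on_add)

lemma C_k_const: "C_k k (\<lambda>_. c)"
proof (induction k arbitrary: c)
  case (Suc k)
  show ?case using Suc[of 0] by simp
qed simp

lemma smooth_sum:
  assumes "finite I" "\<And>i. i \<in> I \<Longrightarrow> smooth (f i)"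
  shows "smooth (\<lambda>x. \<Sum>i\<in>I. f i x)"
  unfolding smooth_def
proof
  fix k show "C_k k (\<lambda>x. \<Sum>i\<in>I. f i x)"
    using assms by (induction I rule: finite_induct) (auto simp: smooth_def intro!: C_k_const C_k_add)
qed

lemma smooth_bounded_linear: "bounded_linear L \<Longrightarrow> smooth f \<Longrightarrow> smooth (\<lambda>x. L (f x))"
  by (simp add: smooth_def C_k_bounded_linear)

lemma smooth_differentiable: "smooth f \<Longrightarrow> f differentiable (at x)"
  unfolding smooth_def by (metis C_k.simps(2))

lemma smooth_derivative: "smooth f \<Longrightarrow> smooth (\<lambda>x. frechet_derivative f (at x) v)"
  unfolding smooth_def by (metis C_k.simps(2))

lemma smooth_C1_periodic: "smooth f \<Longrightarrow> periodic f \<Longrightarrow> C1_periodic f"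
  by (simp add: C1_periodic_def smooth_def)

lemma periodic_derivative:
  "smooth f \<Longrightarrow> periodic f \<Longrightarrow> periodic (\<lambda>x. frechet_derivative f (at x) v)"
  by (auto simp: periodic_def smooth_differentiable frechet_derivative_translate)


text \<open>A phase shift of \<open>\<pi>/2\<close> turns the cosine into (minus) the sine, so derivatives of waves are again
  waves, and smoothness follows by induction on the order of differentiation.\<close>

definition wave :: "real ^ 2 \<Rightarrow> real \<Rightarrow> 'b::real_normed_vector \<Rightarrow> real ^ 2 \<Rightarrow> 'b" where
  "wave w t p x = cos (w \<bullet> x + t) *\<^sub>R p"

lemma wave_has_derivative:
  "(wave w t p has_derivative (\<lambda>v. wave w (t + pi / 2) ((w \<bullet> v) *\<^sub>R p) x)) (at x)"
proof -
  have "((\<lambda>x. cos (w \<bullet> x + t) *\<^sub>R p) has_derivative (\<lambda>v. (- sin (w \<bullet> x + t) * (w \<bullet> v)) *\<^sub>R p)) (at x)"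
    by (auto intro!: derivative_eq_intros)
  moreover have "cos (w \<bullet> x + (t + pi / 2)) = - sin (w \<bullet> x + t)"
    by (simp add: cos_add flip: add.assoc)
  ultimately show ?thesis by (simp add: wave_def[abs_def])
qed

lemma frechet_derivative_wave:
  "frechet_derivative (wave w t p) (at x) = (\<lambda>v. wave w (t + pi / 2) ((w \<bullet> v) *\<^sub>R p) x)"
  by (rule frechet_derivative_at[OF wave_has_derivative, symmetric])

lemma smooth_wave: "smooth (wave w t p)"
  unfolding smooth_def
proof
  fix k show "C_k k (wave w t p)"
  proof (induction k arbitrary: t p)
    case 0
    show ?case by (auto simp: wave_def[abs_def] intro!: continuous_intros)
  next
    case (Suc k)
    have "(\<lambda>x. frechet_derivative (wave w t p) (at x) v) = wave w (t + pi / 2) ((w \<bullet> v) *\<^sub>R p)" for v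
      by (simp add: frechet_derivative_wave)
    then show ?case using Suc differentiableI[OF wave_has_derivative[of w t p]] by simp
  qed
qed

lemma cos_add_Ints_period: "n \<in> \<int> \<Longrightarrow> cos (x + 2 * pi * n) = cos x"
  by (auto elim!: Ints_cases simp: cos_add cos_int_2pin sin_int_2pin)

lemma inner_lattice: "k \<in> lattice \<Longrightarrow> z \<in> lattice \<Longrightarrow> k \<bullet> z \<in> \<int>"
  by (auto simp: lattice_def inner_vec_def intro!: Ints_sum Ints_mult)

lemma periodic_wave: "k \<in> lattice \<Longrightarrow> periodic (wave ((2 * pi) *\<^sub>R k) t p)"
  unfolding periodic_def
proof (intro allI ballI)
  fix x z assume k: "k \<in> lattice" and z: "z \<in> lattice"
  have "(2 * pi) *\<^sub>R k \<bullet> (x + z) + t = ((2 * pi) *\<^sub>R k \<bullet> x + t) + 2 * pi * (k \<bullet> z)"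
    by (simp add: inner_add_right algebra_simps)
  then show "wave ((2 * pi) *\<^sub>R k) t p (x + z) = wave ((2 * pi) *\<^sub>R k) t p x"
    unfolding wave_def using cos_add_Ints_period[OF inner_lattice[OF k z]] by metis
qed

lemma cont_periodic_wave: "k \<in> lattice \<Longrightarrow> cont_periodic (wave ((2 * pi) *\<^sub>R k) t p)"
  by (intro C1_periodic_cont_periodic smooth_C1_periodic smooth_wave periodic_wave)

text \<open>Translation by half a wavelength along \<open>k\<close> changes the sign of the wave, while the mean is translation invariant.\<close>

lemma mean_wave:
  fixes p :: "'b::banach"
  assumes k: "k \<in> lattice" "k \<noteq> 0"
  shows "mean (wave ((2 * pi) *\<^sub>R k) t p) = 0"
proof -
  let ?f = "wave ((2 * pi) *\<^sub>R k) t p" and ?v = "(1 / (2 * (k \<bullet> k))) *\<^sub>R k"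
  have "?f (x + ?v) = - ?f x" for x
  proof -
    have "(2 * pi) *\<^sub>R k \<bullet> (x + ?v) + t = ((2 * pi) *\<^sub>R k \<bullet> x + t) + pi"
      using k by (simp add: inner_add_right)
    then show ?thesis unfolding wave_def by (simp only: cos_periodic_pi scaleR_minus_left)
  qed
  then have "mean ?f = mean (\<lambda>x. - ?f x)"
    using mean_translate[OF cont_periodic_wave[OF k(1)], of t p ?v] by simp
  also have "\<dots> = - mean ?f" by (simp add: mean_def)
  finally have "2 *\<^sub>R mean ?f = 0" by (simp only: scaleR_2 eq_neg_iff_add_eq_0)
  then show ?thesis by simp
qed

lemma partial_wave: "partial i (wave w t p) = wave w (t + pi / 2) (w $ i * p)"
  by (simp add: partial_def fun_eq_iff frechet_derivative_wave inner_axis)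

lemma partial_partial_wave: "partial i (partial j (wave w t p)) x = - (w $ i * w $ j) * wave w t p x"
proof -
  have "w \<bullet> x + (t + pi / 2 + pi / 2) = (w \<bullet> x + t) + pi" by simp
  then have "cos (w \<bullet> x + (t + pi / 2 + pi / 2)) = - cos (w \<bullet> x + t)"
    by (simp only: cos_periodic_pi)
  then show ?thesis by (simp add: partial_wave wave_def)
qed


section \<open>Dual metrics and Laplacians of flat metrics\<close>

text \<open>For \<open>b \<noteq> 0\<close> the inverse of the matrix of \<open>h\<^sub>a\<^sub>,\<^sub>b\<close>.\<close>

definition flat_dual :: "real \<Rightarrow> real \<Rightarrow> real ^ 2 ^ 2" where
  "flat_dual a b = vector [vector [(a\<^sup>2 + b\<^sup>2) / b\<^sup>2, - a / b\<^sup>2], vector [- a / b\<^sup>2, 1 / b\<^sup>2]]"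

lemma matrix_inv_eqI:
  fixes A :: "real ^ 'n ^ 'n"
  assumes "A ** B = mat 1" "B ** A = mat 1"
  shows "matrix_inv A = B"
  unfolding matrix_inv_def
proof (rule some_equality)
  fix C assume "A ** C = mat 1 \<and> C ** A = mat 1"
  then show "C = B" using assms by (metis matrix_mul_assoc matrix_mul_lid matrix_mul_rid)
qed (use assms in simp)

lemma dual_metric_h_flat:
  assumes "b \<noteq> 0"
  shows "dual_metric (h_flat a b) = (\<lambda>_. flat_dual a b)"
proof -
  let ?H = "vector [vector [1, a], vector [a, a\<^sup>2 + b\<^sup>2]] :: real ^ 2 ^ 2"
  have "?H ** flat_dual a b = mat 1"
    using assms
    by (simp add: flat_dual_def vec_eq_iff forall_2 matrix_matrix_mult_def sum_2 mat_def field_simps power2_eq_square)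
  moreover have "flat_dual a b ** ?H = mat 1"
    using assms
    by (simp add: flat_dual_def vec_eq_iff forall_2 matrix_matrix_mult_def sum_2 mat_def field_simps power2_eq_square)
  ultimately have "matrix_inv ?H = flat_dual a b" by (rule matrix_inv_eqI)
  then show ?thesis by (simp add: dual_metric_def h_flat_def fun_eq_iff)
qed

lemma volume_density_h_flat:
  assumes "0 < b" "0 < c"
  shows "volume_density (\<lambda>x. c *\<^sub>R h_flat a b x) = (\<lambda>_. c * b)"
proof
  fix x
  have "det (c *\<^sub>R h_flat a b x) = (c * b)\<^sup>2"
    by (simp add: h_flat_def det_2 power2_eq_square algebra_simps)
  then show "volume_density (\<lambda>x. c *\<^sub>R h_flat a b x) x = c * b"
    using assms by (simp add: volume_density_def)
qed

lemma flat_dual_quadratic: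
  assumes "a\<^sup>2 + b\<^sup>2 = 1"
  shows "\<xi> \<bullet> (flat_dual a b *v \<xi>) = hex_form a \<xi> / b\<^sup>2"
  using assms
  by (simp add: flat_dual_def hex_form_def inner_vec_def matrix_vector_mult_def sum_2 power2_eq_square
      add_divide_distrib diff_divide_distrib algebra_simps)

lemma hex_form_nonneg:
  assumes "\<bar>s\<bar> \<le> 1"
  shows "0 \<le> hex_form s \<xi>"
proof -
  have "hex_form s \<xi> = (\<xi> $ 1 - s * \<xi> $ 2)\<^sup>2 + (1 - s\<^sup>2) * (\<xi> $ 2)\<^sup>2"
    by (simp add: hex_form_def power2_eq_square algebra_simps)
  moreover have "0 \<le> 1 - s\<^sup>2" using assms by (simp add: abs_square_le_1)
  ultimately show ?thesis by simp
qed

lemma flat_dual_in_M_star: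
  assumes ab: "a\<^sup>2 + b\<^sup>2 = 1"
  shows "(\<lambda>_. flat_dual a b) \<in> M_star"
proof -
  have "\<bar>a\<bar> \<le> 1" using ab by (metis abs_square_le_1 add_increasing2 le_add_same_cancel1 zero_le_power2)
  moreover have "transpose (flat_dual a b) = flat_dual a b"
    by (simp add: flat_dual_def transpose_def vec_eq_iff forall_2)
  ultimately show ?thesis
    unfolding M_star_def
    by (simp add: smooth_def C_k_const periodic_def flat_dual_quadratic[OF ab] hex_form_nonneg)
qed

lemma laplacian_h_flat:
  fixes u :: "real ^ 2 \<Rightarrow> real"
  assumes b: "0 < b" and u: "smooth u"
  shows "laplacian (h_flat a b) u x =
    (\<Sum>i\<in>UNIV. \<Sum>j\<in>UNIV. flat_dual a b $ i $ j * partial i (partial j u) x)"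
proof -
  have vol: "volume_density (h_flat a b) = (\<lambda>_. b)"
    using volume_density_h_flat[OF b, of 1 a] by simp
  have D: "(partial j u has_derivative frechet_derivative (partial j u) (at x)) (at x)" for j
    using smooth_differentiable[OF smooth_derivative[OF u]]
    by (simp add: partial_def[abs_def] flip: frechet_derivative_works)
  have "partial i (\<lambda>y. b * (\<Sum>j\<in>UNIV. flat_dual a b $ i $ j * partial j u y)) x =
      b * (\<Sum>j\<in>UNIV. flat_dual a b $ i $ j * partial i (partial j u) x)" for i
  proof -
    have "((\<lambda>y. b * (\<Sum>j\<in>UNIV. flat_dual a b $ i $ j * partial j u y)) has_derivative
        (\<lambda>v. b * (\<Sum>j\<in>UNIV. flat_dual a b $ i $ j * frechet_derivative (partial j u) (at x) v))) (at x)"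
      by (intro has_derivative_mult_right has_derivative_sum D)
    from frechet_derivative_at[OF this, symmetric] show ?thesis by (simp add: partial_def[of i])
  qed
  then show ?thesis
    using b by (simp add: laplacian_def vol dual_metric_h_flat sum_distrib_left[symmetric])
qed


section \<open>The first eigenvalue of the metrics on the unit circle\<close>

lemma differential_nth: "differential u x $ i = frechet_derivative u (at x) (axis i 1)"
  by (simp add: differential_def partial_def)

lemma cont_periodic_quadratic [simp]:
  assumes u: "C1_periodic u" and g: "\<And>i j. cont_periodic (\<lambda>x. g x $ i $ j)"
  shows "cont_periodic (\<lambda>x. differential u x \<bullet> (g x *v differential u x))"
  using u g by (simp add: inner_vec_def matrix_vector_mult_def differential_nth)

lemma unit_circle_poincare:
  fixes u :: "real ^ 2 \<Rightarrow> real"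
  assumes a: "0 \<le> a" "a \<le> 1/2" and ab: "a\<^sup>2 + b\<^sup>2 = 1" and u: "C1_periodic u" and 0: "mean u = 0"
  shows "4 * pi\<^sup>2 / b\<^sup>2 * mean (\<lambda>x. (u x)\<^sup>2)
    \<le> mean (\<lambda>x. differential u x \<bullet> (flat_dual a b *v differential u x))"
proof -
  have "4 * pi\<^sup>2 / b\<^sup>2 * mean (\<lambda>x. (u x)\<^sup>2) \<le> mean (\<lambda>x. hex_form a (differential u x)) / b\<^sup>2"
    using divide_right_mono[OF torus_poincare[OF a u 0], of "b\<^sup>2"] by simp
  also have "\<dots> = mean (\<lambda>x. 1 / b\<^sup>2 * hex_form a (differential u x))"
    by (simp only: mean_mult_left) simp
  finally show ?thesis by (simp add: flat_dual_quadratic[OF ab])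
qed

text \<open>Green's formulas for a constant metric, by partial integration in each pair of indices.\<close>

lemma mean_laplacian:
  fixes u :: "real ^ 2 \<Rightarrow> real"
  assumes b: "0 < b" and u: "smooth u" "periodic u"
  shows "mean (laplacian (h_flat a b) u) = 0"
    and "mean (\<lambda>x. u x * laplacian (h_flat a b) u x) =
      - mean (\<lambda>x. differential u x \<bullet> (flat_dual a b *v differential u x))"
proof -
  have C: "C1_periodic u" "C1_periodic (partial j u)" for j
    using u by (auto intro!: smooth_C1_periodic smooth_derivative periodic_derivative simp: partial_def[abs_def])
  have cp: "cont_periodic (partial i v)" if "C1_periodic v" for i v
    using C1_periodic_derivative[OF that] by (simp add: partial_def[abs_def])
  note cps = cp[OF C(1)] cp[OF C(2)] C1_periodic_cont_periodic[OF C(1)]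
  have z: "mean (partial i (partial j u)) = 0" for i j
    using mean_derivative[OF C(2), of j "axis i 1"] by (simp add: partial_def[where i = i, abs_def])
  show "mean (laplacian (h_flat a b) u) = 0"
    using cps by (simp add: laplacian_h_flat[OF b u(1), abs_def] mean_sum mean_mult_left z)
  have p: "mean (\<lambda>x. u x * partial i (partial j u) x) = - mean (\<lambda>x. partial i u x * partial j u x)" for i j
    using mean_integration_by_parts[OF C] by (simp add: partial_def[of i])
  have "u x * laplacian (h_flat a b) u x =
      (\<Sum>i\<in>UNIV. \<Sum>j\<in>UNIV. flat_dual a b $ i $ j * (u x * partial i (partial j u) x))" for x
    by (simp add: laplacian_h_flat[OF b u(1)] sum_distrib_left mult.left_commute)
  then have "mean (\<lambda>x. u x * laplacian (h_flat a b) u x) =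
      - (\<Sum>i\<in>UNIV. \<Sum>j\<in>UNIV. flat_dual a b $ i $ j * mean (\<lambda>x. partial i u x * partial j u x))"
    using cps by (simp add: mean_sum mean_mult_left p sum_negf)
  also have "(\<Sum>i\<in>UNIV. \<Sum>j\<in>UNIV. flat_dual a b $ i $ j * mean (\<lambda>x. partial i u x * partial j u x)) =
      mean (\<lambda>x. \<Sum>i\<in>UNIV. \<Sum>j\<in>UNIV. flat_dual a b $ i $ j * (partial i u x * partial j u x))"
    using cps by (simp add: mean_sum mean_mult_left)
  also have "\<dots> = mean (\<lambda>x. differential u x \<bullet> (flat_dual a b *v differential u x))"
    by (simp add: inner_vec_def matrix_vector_mult_def differential_def sum_distrib_left mult_ac)
  finally show "mean (\<lambda>x. u x * laplacian (h_flat a b) u x) =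
      - mean (\<lambda>x. differential u x \<bullet> (flat_dual a b *v differential u x))" .
qed

text \<open>For \<open>a = 1/2\<close> the condition \<open>hex_form a k = 1\<close> holds at the six shortest frequencies
  \<open>\<plusminus>(1,0)\<close>, \<open>\<plusminus>(0,1)\<close>, \<open>\<plusminus>(1,1)\<close>.\<close>

lemma wave_eigenspace:
  fixes p :: real
  assumes b: "0 < b" and ab: "a\<^sup>2 + b\<^sup>2 = 1" and k: "k \<in> lattice" "hex_form a k = 1"
  shows "wave ((2 * pi) *\<^sub>R k) t p \<in> eigenspace (h_flat a b) (4 * pi\<^sup>2 / b\<^sup>2)"
  unfolding eigenspace_def
proof (intro CollectI conjI allI)
  fix x
  have "- laplacian (h_flat a b) (wave ((2 * pi) *\<^sub>R k) t p) x =
      4 * pi\<^sup>2 * (k \<bullet> (flat_dual a b *v k)) * wave ((2 * pi) *\<^sub>R k) t p x"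
    by (simp add: laplacian_h_flat[OF b smooth_wave] partial_partial_wave inner_vec_def
        matrix_vector_mult_def sum_2 power2_eq_square algebra_simps)
  then show "- laplacian (h_flat a b) (wave ((2 * pi) *\<^sub>R k) t p) x =
      4 * pi\<^sup>2 / b\<^sup>2 * wave ((2 * pi) *\<^sub>R k) t p x"
    by (simp add: flat_dual_quadratic[OF ab] k)
qed (auto simp: smooth_wave periodic_wave k)

text \<open>An eigenfunction with eigenvalue \<open>\<nu> > 0\<close> has mean zero by the first Green formula; its Rayleigh
  quotient is \<open>\<nu>\<close> by the second, so the Poincare inequality bounds \<open>\<nu>\<close> below.\<close>

lemma first_eigenvalue:
  assumes a: "0 \<le> a" "a \<le> 1/2" and b: "0 < b" and ab: "a\<^sup>2 + b\<^sup>2 = 1"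
  shows "is_first_eigenvalue (h_flat a b) (4 * pi\<^sup>2 / b\<^sup>2)"
  unfolding is_first_eigenvalue_def
proof (intro conjI allI impI)
  show "0 < 4 * pi\<^sup>2 / b\<^sup>2" using b by simp
  let ?w = "wave ((2 * pi) *\<^sub>R axis 1 1) 0 (1::real)"
  have "?w \<in> eigenspace (h_flat a b) (4 * pi\<^sup>2 / b\<^sup>2)"
    by (rule wave_eigenspace[OF b ab]) (auto simp: lattice_def axis_def hex_form_def)
  moreover have "?w 0 \<noteq> 0" by (simp add: wave_def)
  ultimately show "eigenvalue (h_flat a b) (4 * pi\<^sup>2 / b\<^sup>2)" unfolding eigenvalue_def by metis
next
  fix \<nu> assume "0 < \<nu> \<and> eigenvalue (h_flat a b) \<nu>"
  then obtain u where \<nu>: "0 < \<nu>" and u: "smooth u" "periodic u" "u \<noteq> (\<lambda>_. 0)"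
    and eq: "\<And>x. laplacian (h_flat a b) u x = - \<nu> * u x"
    by (auto simp: eigenvalue_def eigenspace_def minus_equation_iff[of _ "_ * _"])
  have C: "C1_periodic u" using u by (simp add: smooth_C1_periodic)
  have "- \<nu> * mean u = 0"
    using mean_laplacian(1)[OF b u(1,2), of a] by (simp only: eq[abs_def] mean_mult_left)
  then have 0: "mean u = 0" using \<nu> by simp
  have "mean (\<lambda>x. u x * laplacian (h_flat a b) u x) = - \<nu> * mean (\<lambda>x. (u x)\<^sup>2)"
    by (subst mean_mult_left[symmetric]) (simp add: eq power2_eq_square mult_ac)
  then have "4 * pi\<^sup>2 / b\<^sup>2 * mean (\<lambda>x. (u x)\<^sup>2) \<le> \<nu> * mean (\<lambda>x. (u x)\<^sup>2)"
    using mean_laplacian(2)[OF b u(1,2), of a] unit_circle_poincare[OF a ab C 0] by simp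
  moreover have "0 < mean (\<lambda>x. (u x)\<^sup>2)"
    by (rule mean_square_pos[OF C1_periodic_cont_periodic[OF C] u(3)])
  ultimately show "4 * pi\<^sup>2 / b\<^sup>2 \<le> \<nu>" by (rule mult_right_le_imp_le)
qed

section \<open>The first-eigenvalue maximization problem\<close>

lemma torus_integral_const_density: "torus_integral (\<lambda>_. \<rho>) f = \<rho> *\<^sub>R mean f"
  by (simp add: torus_integral_def mean_def One_vec_eq)

lemma torus_mean_const_density: "\<rho> \<noteq> 0 \<Longrightarrow> torus_mean (\<lambda>_. \<rho>) f = mean f"
  by (simp add: torus_mean_def torus_integral_const_density mean_const)

text \<open>The density occurs in both integrals of the Rayleigh quotient and cancels.\<close>

lemma lambda1_const_density:
  assumes "\<rho> \<noteq> 0"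
  shows "lambda1 (\<lambda>_. \<rho>) g =
    Inf {mean (\<lambda>x. differential u x \<bullet> (g x *v differential u x)) / mean (\<lambda>x. (u x)\<^sup>2) | u.
      C1_periodic u \<and> u \<noteq> (\<lambda>_. 0) \<and> mean u = 0}"
  using assms by (simp add: lambda1_def torus_integral_const_density C1_periodic_def conj_ac)

text \<open>The wave \<open>cos 2\<pi>x\<close> shows that there are test functions at all, which the infimum of a set of reals
  requires.\<close>

lemma lambda1_geI:
  assumes \<rho>: "\<rho> \<noteq> 0"
    and le: "\<And>u. C1_periodic u \<Longrightarrow> mean u = 0 \<Longrightarrow>
      \<mu> * mean (\<lambda>x. (u x)\<^sup>2) \<le> mean (\<lambda>x. differential u x \<bullet> (g x *v differential u x))"
  shows "\<mu> \<le> lambda1 (\<lambda>_. \<rho>) g"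
  unfolding lambda1_const_density[OF \<rho>]
proof (rule cInf_greatest)
  let ?w = "wave ((2 * pi) *\<^sub>R axis 1 1) 0 (1::real)"
  have k: "axis 1 1 \<in> lattice" by (auto simp: lattice_def axis_def)
  have "?w 0 \<noteq> 0" by (simp add: wave_def)
  then have "?w \<noteq> (\<lambda>_. 0)" by metis
  moreover have "mean ?w = 0" by (rule mean_wave[OF k]) (simp add: axis_eq_0_iff)
  moreover have "C1_periodic ?w" by (intro smooth_C1_periodic smooth_wave periodic_wave k)
  ultimately show "{mean (\<lambda>x. differential u x \<bullet> (g x *v differential u x)) / mean (\<lambda>x. (u x)\<^sup>2) | u.
      C1_periodic u \<and> u \<noteq> (\<lambda>_. 0) \<and> mean u = 0} \<noteq> {}" by blast
next
  fix r assume "r \<in> {mean (\<lambda>x. differential u x \<bullet> (g x *v differential u x)) / mean (\<lambda>x. (u x)\<^sup>2) | u.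
      C1_periodic u \<and> u \<noteq> (\<lambda>_. 0) \<and> mean u = 0}"
  then obtain u where u: "C1_periodic u" "u \<noteq> (\<lambda>_. 0)" "mean u = 0"
    and r: "r = mean (\<lambda>x. differential u x \<bullet> (g x *v differential u x)) / mean (\<lambda>x. (u x)\<^sup>2)" by blast
  have "0 < mean (\<lambda>x. (u x)\<^sup>2)"
    by (rule mean_square_pos[OF C1_periodic_cont_periodic[OF u(1)] u(2)])
  then show "\<mu> \<le> r" using le[OF u(1,3)] r by (simp add: pos_le_divide_eq)
qed

text \<open>Positive semidefiniteness makes the Rayleigh quotients nonnegative, so their infimum, taken in the
  reals, is indeed a lower bound.\<close>

lemma lambda1_M_star:
  assumes \<rho>: "\<rho> \<noteq> 0" and g: "g \<in> M_star"
  shows "0 \<le> lambda1 (\<lambda>_. \<rho>) g"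
    and "C1_periodic u \<Longrightarrow> mean u = 0 \<Longrightarrow>
      lambda1 (\<lambda>_. \<rho>) g * mean (\<lambda>x. (u x)\<^sup>2) \<le> mean (\<lambda>x. differential u x \<bullet> (g x *v differential u x))"
proof -
  let ?E = "\<lambda>u. mean (\<lambda>x. differential u x \<bullet> (g x *v differential u x))"
  have E: "0 \<le> ?E u" for u
    using g by (intro mean_nonneg) (auto simp: M_star_def)
  show "0 \<le> lambda1 (\<lambda>_. \<rho>) g" by (rule lambda1_geI[OF \<rho>]) (simp add: E)
  assume u: "C1_periodic u" "mean u = 0"
  show "lambda1 (\<lambda>_. \<rho>) g * mean (\<lambda>x. (u x)\<^sup>2) \<le> ?E u"
  proof (cases "u = (\<lambda>_. 0)")
    case True
    then show ?thesis using E[of u] by (simp add: mean_const)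
  next
    case False
    then have pos: "0 < mean (\<lambda>x. (u x)\<^sup>2)"
      by (rule mean_square_pos[OF C1_periodic_cont_periodic[OF u(1)]])
    have "lambda1 (\<lambda>_. \<rho>) g \<le> ?E u / mean (\<lambda>x. (u x)\<^sup>2)"
      unfolding lambda1_const_density[OF \<rho>]
    proof (rule cInf_lower)
      show "bdd_below {?E u / mean (\<lambda>x. (u x)\<^sup>2) | u. C1_periodic u \<and> u \<noteq> (\<lambda>_. 0) \<and> mean u = 0}"
        by (rule bdd_belowI[of _ 0]) (auto intro!: divide_nonneg_nonneg E mean_nonneg)
    qed (use u False in blast)
    then show ?thesis using pos by (simp add: pos_le_divide_eq)
  qed
qed

lemma M_star_cont_periodic:
  assumes "g \<in> M_star"
  shows "cont_periodic (\<lambda>x. g x $ i $ j)"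
proof -
  have "C_k 0 g" using assms unfolding M_star_def smooth_def by blast
  then have "continuous_on UNIV g" by simp
  then show ?thesis
    using assms by (auto simp: cont_periodic_def M_star_def periodic_def intro!: continuous_intros)
qed

text \<open>Each coordinate of \<open>\<phi>\<close> is a test function for \<open>\<lambda>\<^sub>1\<close>. Summing the energy densities over the coordinates
  contracts \<open>g\<^sup>*\<close> with the pullback metric of \<open>\<phi>\<close>, which is \<open>h\<close>.\<close>

lemma lambda1_isometric_bound:
  fixes \<phi> :: "real ^ 2 \<Rightarrow> real ^ 'n"
  assumes \<rho>: "\<rho> \<noteq> 0" and g: "g \<in> M_star" and \<phi>: "isometric_embedding h \<phi>" and 0: "mean \<phi> = 0"
  shows "lambda1 (\<lambda>_. \<rho>) g * mean (\<lambda>x. (norm (\<phi> x))\<^sup>2) \<le> mean (pairing g h)"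
proof -
  let ?u = "\<lambda>i x. \<phi> x $ i"
  have sm: "smooth \<phi>" "periodic \<phi>"
    and iso: "\<And>x v w. frechet_derivative \<phi> (at x) v \<bullet> frechet_derivative \<phi> (at x) w = v \<bullet> (h x *v w)"
    using \<phi> by (auto simp: isometric_embedding_def)
  have C: "C1_periodic (?u i)" for i
    using sm by (intro smooth_C1_periodic smooth_bounded_linear[OF bounded_linear_vec_nth])
      (auto simp: periodic_def)
  have cp: "cont_periodic \<phi>" using sm by (simp add: smooth_C1_periodic)
  have mean0: "mean (?u i) = 0" for i
    using integral_linear[OF cont_periodic_integrable[OF cp] bounded_linear_vec_nth[of i]] 0
    by (simp add: mean_def o_def)
  have D: "frechet_derivative (?u i) (at x) v = frechet_derivative \<phi> (at x) v $ i" for i x v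
  proof -
    have "(?u i has_derivative (\<lambda>v. frechet_derivative \<phi> (at x) v $ i)) (at x)"
      using smooth_differentiable[OF sm(1)]
      by (intro bounded_linear.has_derivative[OF bounded_linear_vec_nth]) (simp flip: frechet_derivative_works)
    then show ?thesis by (metis frechet_derivative_at)
  qed
  have pw: "(\<Sum>i\<in>UNIV. differential (?u i) x \<bullet> (g x *v differential (?u i) x)) = pairing g h x" for x
  proof -
    let ?D = "\<lambda>j. frechet_derivative \<phi> (at x) (axis j 1)"
    have hjk: "(\<Sum>i\<in>UNIV. ?D j $ i * ?D k $ i) = h x $ j $ k" for j k
      using iso[of x "axis j 1" "axis k 1"]
      by (simp add: inner_vec_def[of "?D j"] matrix_vector_mult_basis inner_axis' column_def)
    have "(\<Sum>i\<in>UNIV. differential (?u i) x \<bullet> (g x *v differential (?u i) x)) =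
        (\<Sum>i\<in>UNIV. \<Sum>j\<in>UNIV. \<Sum>k\<in>UNIV. g x $ j $ k * (?D j $ i * ?D k $ i))"
      by (simp add: inner_vec_def matrix_vector_mult_def differential_nth D sum_distrib_left mult_ac)
    also have "\<dots> = (\<Sum>j\<in>UNIV. \<Sum>k\<in>UNIV. \<Sum>i\<in>UNIV. g x $ j $ k * (?D j $ i * ?D k $ i))"
      by (subst sum.swap) (intro sum.cong refl sum.swap)
    also have "\<dots> = pairing g h x" by (simp add: pairing_def hjk flip: sum_distrib_left)
    finally show ?thesis .
  qed
  have "lambda1 (\<lambda>_. \<rho>) g * mean (\<lambda>x. (norm (\<phi> x))\<^sup>2) = lambda1 (\<lambda>_. \<rho>) g * mean (\<lambda>x. \<Sum>i\<in>UNIV. (?u i x)\<^sup>2)"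
    by (simp only: power2_norm_eq_inner inner_vec_def) (simp add: power2_eq_square)
  also have "\<dots> = (\<Sum>i\<in>UNIV. lambda1 (\<lambda>_. \<rho>) g * mean (\<lambda>x. (?u i x)\<^sup>2))"
    using C by (subst mean_sum) (simp_all add: sum_distrib_left)
  also have "\<dots> \<le> (\<Sum>i\<in>UNIV. mean (\<lambda>x. differential (?u i) x \<bullet> (g x *v differential (?u i) x)))"
    by (intro sum_mono lambda1_M_star(2)[OF \<rho> g] C mean0)
  also have "\<dots> = mean (pairing g h)"
    using C M_star_cont_periodic[OF g] by (subst mean_sum[symmetric]) (simp_all add: pw)
  finally show ?thesis .
qed

text \<open>By \<open>lambda1_isometric_bound\<close> the quotient of every competitor is at most \<open>1 / \<integral>\<parallel>\<phi>\<parallel>\<^sup>2\<close>; a competitor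
  with \<open>\<integral> (g\<^sup>*, h) = 0\<close> has quotient \<open>0\<close> by the convention for division. The assumption \<open>sharp\<close> says
  that \<open>g\<close> attains the bound.\<close>

lemma solves_maximizationI:
  fixes \<phi> :: "real ^ 2 \<Rightarrow> real ^ 'n"
  assumes \<rho>: "\<rho> \<noteq> 0" and \<phi>: "isometric_embedding h \<phi>" "mean \<phi> = 0"
    and g: "g \<in> M_star" and pos: "0 < mean (pairing g h)"
    and sharp: "mean (pairing g h) \<le> lambda1 (\<lambda>_. \<rho>) g * mean (\<lambda>x. (norm (\<phi> x))\<^sup>2)"
  shows "solves_maximization (\<lambda>_. \<rho>) h g"
proof -
  let ?R = "mean (\<lambda>x. (norm (\<phi> x))\<^sup>2)"
  have R: "0 \<le> ?R" by (rule mean_nonneg) simp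
  then have Rpos: "0 < ?R" using pos sharp by (cases "?R = 0") auto
  have le: "lambda1 (\<lambda>_. \<rho>) k / mean (pairing k h) \<le> 1 / ?R" if k: "k \<in> M_star" for k
  proof -
    have b: "lambda1 (\<lambda>_. \<rho>) k * ?R \<le> mean (pairing k h)"
      by (rule lambda1_isometric_bound[OF \<rho> k \<phi>])
    then have "0 \<le> mean (pairing k h)"
      using mult_nonneg_nonneg[OF lambda1_M_star(1)[OF \<rho> k] R] by linarith
    then show ?thesis using b Rpos by (cases "mean (pairing k h) = 0") (auto simp: field_simps)
  qed
  have ge: "1 / ?R \<le> lambda1 (\<lambda>_. \<rho>) g / mean (pairing g h)"
    using sharp pos Rpos by (simp add: field_simps)
  have "g \<noteq> (\<lambda>_. 0)" using pos by (auto simp: pairing_def[abs_def] mean_const)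
  then show ?thesis
    unfolding solves_maximization_def is_arg_max_def torus_mean_const_density[OF \<rho>]
    using le ge g by (auto simp: not_less intro: order_trans)
qed


section \<open>Inflated maps\<close>

lemma bounded_linear_l2_nth: "bounded_linear (\<lambda>x. l2_nth x n)"
proof (rule bounded_linear_intro[where K = 1])
  show "l2_nth (x + y) n = l2_nth x n + l2_nth y n" for x y by transfer simp
  show "l2_nth (r *\<^sub>R x) n = r *\<^sub>R l2_nth x n" for r x by transfer simp
  show "norm (l2_nth x n) \<le> norm x * 1" for x by (simp add: abs_l2_nth_le_norm)
qed

text \<open>The Poincare inequality is applied to the first \<open>N\<close> coordinates of \<open>\<psi>\<close>. The decomposition of the
  energy density into squares of \<open>D\<psi>(e)\<close> for \<open>e = e\<^sub>1, e\<^sub>2, e\<^sub>1 - e\<^sub>2\<close> lets one use \<open>\<psi>\<^sup>*h\<^sub>l\<^sub>2 \<le> h\<close> on each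
  vector, and the same decomposition applied to \<open>h\<close> reassembles the pairing. The limit in \<open>N\<close> is
  taken by dominated convergence.\<close>

lemma short_map_bound:
  fixes \<psi> :: "real ^ 2 \<Rightarrow> l2"
  assumes a: "0 \<le> a" "a \<le> 1/2" and ab: "a\<^sup>2 + b\<^sup>2 = 1" and b: "b \<noteq> 0"
    and h: "\<And>i j. cont_periodic (\<lambda>x. h x $ i $ j)"
    and sm: "smooth \<psi>" "periodic \<psi>"
    and short: "\<And>x v. (norm (frechet_derivative \<psi> (at x) v))\<^sup>2 \<le> v \<bullet> (h x *v v)"
    and 0: "mean \<psi> = 0"
  shows "4 * pi\<^sup>2 / b\<^sup>2 * mean (\<lambda>x. (norm (\<psi> x))\<^sup>2) \<le> mean (pairing (\<lambda>_. flat_dual a b) h)"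
proof -
  let ?u = "\<lambda>n x. l2_nth (\<psi> x) n" and ?P = "pairing (\<lambda>_. flat_dual a b) h"
  define D where "D v x = frechet_derivative \<psi> (at x) v" for v x
  define e1 e2 :: "real ^ 2" where "e1 = axis 1 1" and "e2 = axis 2 1"
  have C: "C1_periodic (?u n)" for n
    using sm by (intro smooth_C1_periodic smooth_bounded_linear[OF bounded_linear_l2_nth])
      (auto simp: periodic_def)
  have cp: "cont_periodic \<psi>" using sm by (simp add: smooth_C1_periodic)
  have cpP: "cont_periodic ?P" unfolding pairing_def[abs_def] using h by simp
  have cpN: "cont_periodic (\<lambda>x. (norm (\<psi> x))\<^sup>2)"
    using cp by (auto simp: cont_periodic_def periodic_def intro!: continuous_intros)
  have mean0: "mean (?u n) = 0" for n
    using integral_linear[OF cont_periodic_integrable[OF cp] bounded_linear_l2_nth[of n]] 0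
    by (simp add: mean_def o_def zero_l2.rep_eq)
  have Du: "frechet_derivative (?u n) (at x) v = l2_nth (D v x) n" for n x v
  proof -
    have "(?u n has_derivative (\<lambda>v. l2_nth (D v x) n)) (at x)"
      using smooth_differentiable[OF sm(1)] unfolding D_def
      by (intro bounded_linear.has_derivative[OF bounded_linear_l2_nth]) (simp flip: frechet_derivative_works)
    then show ?thesis by (metis frechet_derivative_at)
  qed
  have D12: "D (e1 - e2) x = D e1 x - D e2 x" for x
    unfolding D_def
    by (rule linear_diff[OF has_derivative_linear[of \<psi> _ "at x"]])
      (use smooth_differentiable[OF sm(1)] in \<open>simp flip: frechet_derivative_works\<close>)
  have energy: "(\<Sum>n<N. differential (?u n) x \<bullet> (flat_dual a b *v differential (?u n) x)) \<le> ?P x" for N x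
  proof -
    have part: "(\<Sum>n<N. (l2_nth (D v x) n)\<^sup>2) \<le> v \<bullet> (h x *v v)" for v
      using sum_l2_le_norm short[of x v] unfolding D_def by (rule order_trans)
    have "(\<Sum>n<N. hex_form a (differential (?u n) x)) =
        (\<Sum>n<N. (1 - a) * ((l2_nth (D e1 x) n)\<^sup>2 + (l2_nth (D e2 x) n)\<^sup>2) + a * (l2_nth (D (e1 - e2) x) n)\<^sup>2)"
      unfolding D12 l2_nth_diff
      by (simp add: hex_form_def differential_nth Du power2_eq_square algebra_simps e1_def e2_def)
    also have "\<dots> = (1 - a) * ((\<Sum>n<N. (l2_nth (D e1 x) n)\<^sup>2) + (\<Sum>n<N. (l2_nth (D e2 x) n)\<^sup>2))
        + a * (\<Sum>n<N. (l2_nth (D (e1 - e2) x) n)\<^sup>2)"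
      by (simp only: sum.distrib flip: sum_distrib_left)
    also have "\<dots> \<le> (1 - a) * (e1 \<bullet> (h x *v e1) + e2 \<bullet> (h x *v e2)) + a * ((e1 - e2) \<bullet> (h x *v (e1 - e2)))"
      using a part by (intro add_mono mult_left_mono) auto
    also have "\<dots> = b\<^sup>2 * ?P x"
      using b by (simp add: e1_def e2_def axis_def inner_vec_def matrix_vector_mult_def sum_2 pairing_def
          flat_dual_def ab algebra_simps)
    finally have "(\<Sum>n<N. hex_form a (differential (?u n) x)) / b\<^sup>2 \<le> ?P x"
      using b by (simp add: divide_simps mult.commute)
    then show ?thesis by (simp add: flat_dual_quadratic[OF ab] sum_divide_distrib)
  qed
  have partial_bound: "4 * pi\<^sup>2 / b\<^sup>2 * mean (\<lambda>x. \<Sum>n<N. (?u n x)\<^sup>2) \<le> mean ?P" for N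
  proof -
    have "4 * pi\<^sup>2 / b\<^sup>2 * mean (\<lambda>x. \<Sum>n<N. (?u n x)\<^sup>2) = (\<Sum>n<N. 4 * pi\<^sup>2 / b\<^sup>2 * mean (\<lambda>x. (?u n x)\<^sup>2))"
      using C by (subst mean_sum) (simp_all add: sum_distrib_left)
    also have "\<dots> \<le> (\<Sum>n<N. mean (\<lambda>x. differential (?u n) x \<bullet> (flat_dual a b *v differential (?u n) x)))"
      by (intro sum_mono unit_circle_poincare[OF a ab C mean0])
    also have "\<dots> = mean (\<lambda>x. \<Sum>n<N. differential (?u n) x \<bullet> (flat_dual a b *v differential (?u n) x))"
      using C by (subst mean_sum) simp_all
    also have "\<dots> \<le> mean ?P"
      using C cpP energy by (intro mean_mono) simp_all
    finally show ?thesis .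
  qed
  have "(\<lambda>N. mean (\<lambda>x. \<Sum>n<N. (?u n x)\<^sup>2)) \<longlonglongrightarrow> mean (\<lambda>x. (norm (\<psi> x))\<^sup>2)"
    unfolding mean_def
  proof (rule dominated_convergence(2))
    show "(\<lambda>x. \<Sum>n<N. (?u n x)\<^sup>2) integrable_on cbox 0 One" for N
      using C by (intro cont_periodic_integrable) simp
    show "(\<lambda>x. (norm (\<psi> x))\<^sup>2) integrable_on cbox 0 One"
      by (rule cont_periodic_integrable[OF cpN])
    show "norm (\<Sum>n<N. (?u n x)\<^sup>2) \<le> (norm (\<psi> x))\<^sup>2" for N x
      using sum_l2_le_norm by (simp add: sum_nonneg)
    show "(\<lambda>N. \<Sum>n<N. (?u n x)\<^sup>2) \<longlonglongrightarrow> (norm (\<psi> x))\<^sup>2" for x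
      using norm_l2_sums by (simp add: sums_def)
  qed
  from tendsto_mult_left[OF this, of "4 * pi\<^sup>2 / b\<^sup>2"] show ?thesis
    by (rule tendsto_upperbound) (intro always_eventually allI partial_bound, simp)
qed

text \<open>The assumption \<open>sharp\<close> says that \<open>\<phi>\<close> attains the bound of \<open>short_map_bound\<close>.\<close>

lemma inflatedI:
  fixes \<phi> :: "real ^ 2 \<Rightarrow> real ^ 6"
  assumes \<rho>: "\<rho> \<noteq> 0" and a: "0 \<le> a" "a \<le> 1/2" and ab: "a\<^sup>2 + b\<^sup>2 = 1" and b: "b \<noteq> 0"
    and h: "\<And>i j. cont_periodic (\<lambda>x. h x $ i $ j)"
    and \<phi>: "isometric_embedding h \<phi>" "mean \<phi> = 0"
    and sharp: "mean (pairing (\<lambda>_. flat_dual a b) h) \<le> 4 * pi\<^sup>2 / b\<^sup>2 * mean (\<lambda>x. (norm (\<phi> x))\<^sup>2)"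
  shows "inflated (\<lambda>_. \<rho>) h (l2_of_R6 \<circ> \<phi>)"
proof -
  have sm: "smooth \<phi>" "periodic \<phi>"
    and iso: "\<And>x v w. frechet_derivative \<phi> (at x) v \<bullet> frechet_derivative \<phi> (at x) w = v \<bullet> (h x *v w)"
    using \<phi> by (auto simp: isometric_embedding_def)
  have L: "bounded_linear l2_of_R6" using linear_l2_of_R6 by (simp add: linear_conv_bounded_linear)
  have norm_L: "(norm (l2_of_R6 v))\<^sup>2 = (norm v)\<^sup>2" for v
    by (simp add: power2_norm_eq_inner inner_l2_of_R6)
  have cp: "cont_periodic \<phi>" using sm by (simp add: smooth_C1_periodic)
  have D: "frechet_derivative (l2_of_R6 \<circ> \<phi>) (at x) v = l2_of_R6 (frechet_derivative \<phi> (at x) v)" for x v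
  proof -
    have "((\<lambda>x. l2_of_R6 (\<phi> x)) has_derivative (\<lambda>v. l2_of_R6 (frechet_derivative \<phi> (at x) v))) (at x)"
      using smooth_differentiable[OF sm(1)]
      by (intro bounded_linear.has_derivative[OF L]) (simp flip: frechet_derivative_works)
    then show ?thesis unfolding o_def by (metis frechet_derivative_at)
  qed
  have "smooth (l2_of_R6 \<circ> \<phi>)" "periodic (l2_of_R6 \<circ> \<phi>)"
    using sm smooth_bounded_linear[OF L] by (auto simp: o_def periodic_def)
  moreover have "(norm (frechet_derivative (l2_of_R6 \<circ> \<phi>) (at x) v))\<^sup>2 \<le> v \<bullet> (h x *v v)" for x v
    by (simp only: D norm_L) (simp add: power2_norm_eq_inner iso)
  moreover have "mean (l2_of_R6 \<circ> \<phi>) = 0"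
    using integral_linear[OF cont_periodic_integrable[OF cp] L] \<phi>(2) bounded_linear.linear[OF L]
    by (simp add: mean_def linear_0)
  moreover have "mean (\<lambda>x. (norm (\<psi> x))\<^sup>2) \<le> mean (\<lambda>x. (norm (\<phi> x))\<^sup>2)"
    if "smooth \<psi>" "periodic \<psi>" "\<And>x v. (norm (frechet_derivative \<psi> (at x) v))\<^sup>2 \<le> v \<bullet> (h x *v v)"
      "mean \<psi> = 0" for \<psi> :: "real ^ 2 \<Rightarrow> l2"
  proof -
    have "4 * pi\<^sup>2 / b\<^sup>2 * mean (\<lambda>x. (norm (\<psi> x))\<^sup>2) \<le> 4 * pi\<^sup>2 / b\<^sup>2 * mean (\<lambda>x. (norm (\<phi> x))\<^sup>2)"
      using short_map_bound[OF a ab b h that] sharp by linarith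
    moreover have "0 < 4 * pi\<^sup>2 / b\<^sup>2" using b by simp
    ultimately show ?thesis by (rule mult_left_le_imp_le)
  qed
  ultimately show ?thesis
    unfolding inflated_def is_arg_max_def torus_mean_const_density[OF \<rho>]
    by (simp add: norm_L) (meson not_less)
qed


section \<open>The embedding by three circles\<close>

text \<open>The frequencies \<open>(1,0)\<close>, \<open>(0,1)\<close>, \<open>(1,1)\<close> for \<open>j = 0, 1, 2\<close>.\<close>

definition hex_direction :: "nat \<Rightarrow> real ^ 2" where
  "hex_direction j = vector [if j = 1 then 0 else 1, if j = 0 then 0 else 1]"

lemma hex_direction_nth [simp]:
  "hex_direction j $ 1 = (if j = 1 then 0 else 1)" "hex_direction j $ 2 = (if j = 0 then 0 else 1)"
  by (simp_all add: hex_direction_def)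

lemma hex_direction_lattice: "hex_direction j \<in> lattice"
  by (simp add: lattice_def forall_2)

lemma hex_direction_nonzero: "hex_direction j \<noteq> 0"
  by (simp add: vec_eq_iff forall_2)

lemma hex_form_hex_direction: "hex_form (1/2) (hex_direction j) = 1"
  by (simp add: hex_form_def)

definition index6 :: "6 \<Rightarrow> nat" where
  "index6 = inv_into {..<6} of_nat"

lemma bij_betw_index6: "bij_betw index6 UNIV {..<6}"
  unfolding index6_def by (rule bij_betw_inv_into[OF bij_betw_of_nat_6])

lemma index6_of_nat: "n < 6 \<Longrightarrow> index6 (of_nat n) = n"
  using bij_betw_inv_into_left[OF bij_betw_of_nat_6] by (simp add: index6_def)

text \<open>Coordinates \<open>2j\<close> and \<open>2j + 1\<close> will carry the two coordinates of the \<open>j\<close>-th circle.\<close>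

lemma sum_index6: "(\<Sum>i\<in>UNIV. F (index6 i)) = (\<Sum>j<3. F (2 * j) + F (2 * j + 1 :: nat) :: real)"
proof -
  have "(\<Sum>i\<in>UNIV. F (index6 i)) = (\<Sum>n<6. F n)"
    by (rule sum.reindex_bij_betw[OF bij_betw_index6])
  then show ?thesis by (simp add: eval_nat_numeral)
qed

lemma sum_lessThan_3: "(\<Sum>j<3. F j) = F 0 + F 1 + F (2::nat)"
  by (simp add: eval_nat_numeral)

text \<open>The \<open>j\<close>-th circle is \<open>A\<^sub>j (cos \<theta>, sin \<theta>)\<close> with \<open>\<theta> = 2\<pi> k\<^sub>j \<cdot> x\<close>, where \<open>k\<^sub>j\<close> is the \<open>j\<close>-th frequency;
  the parity of the coordinate index selects between cosine and, by the phase \<open>-\<pi>/2\<close>, sine.\<close>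

definition hex_torus :: "(nat \<Rightarrow> real) \<Rightarrow> real ^ 2 \<Rightarrow> real ^ 6" where
  "hex_torus A x = (\<Sum>i\<in>UNIV. wave ((2 * pi) *\<^sub>R hex_direction (index6 i div 2))
     (- (real (index6 i mod 2) * (pi / 2))) (axis i (A (index6 i div 2))) x)"

lemma hex_torus_nth:
  "hex_torus A x $ i = wave ((2 * pi) *\<^sub>R hex_direction (index6 i div 2))
     (- (real (index6 i mod 2) * (pi / 2))) (A (index6 i div 2)) x"
  by (simp add: hex_torus_def wave_def axis_def if_distrib sum.delta cong: if_cong)

lemma hex_torus_derivative_nth:
  "frechet_derivative (hex_torus A) (at x) v $ i = wave ((2 * pi) *\<^sub>R hex_direction (index6 i div 2))
     (- (real (index6 i mod 2) * (pi / 2)) + pi / 2)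
     (((2 * pi) *\<^sub>R hex_direction (index6 i div 2) \<bullet> v) * A (index6 i div 2)) x"
proof -
  have "(hex_torus A has_derivative (\<lambda>v. \<Sum>i\<in>UNIV. wave ((2 * pi) *\<^sub>R hex_direction (index6 i div 2))
      (- (real (index6 i mod 2) * (pi / 2)) + pi / 2)
      (((2 * pi) *\<^sub>R hex_direction (index6 i div 2) \<bullet> v) *\<^sub>R axis i (A (index6 i div 2))) x)) (at x)"
    unfolding hex_torus_def[abs_def] by (intro has_derivative_sum wave_has_derivative)
  from frechet_derivative_at[OF this, symmetric] show ?thesis
    by (simp add: wave_def axis_def if_distrib sum.delta cong: if_cong)
qed

text \<open>On each circle the squares of sine and cosine add up, which removes the dependence on \<open>x\<close>.\<close>

lemma hex_torus_inner_derivative: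
  "frechet_derivative (hex_torus A) (at x) v \<bullet> frechet_derivative (hex_torus A) (at x) w =
    4 * pi\<^sup>2 * (\<Sum>j<3. (A j)\<^sup>2 * (hex_direction j \<bullet> v) * (hex_direction j \<bullet> w))"
proof -
  let ?y = "\<lambda>j. 2 * pi * (hex_direction j \<bullet> x)"
  define F where "F n = (cos (?y (n div 2) + (- (real (n mod 2) * (pi / 2)) + pi / 2)))\<^sup>2 *
    (4 * pi\<^sup>2 * ((A (n div 2))\<^sup>2 * (hex_direction (n div 2) \<bullet> v) * (hex_direction (n div 2) \<bullet> w)))" for n
  have "frechet_derivative (hex_torus A) (at x) v \<bullet> frechet_derivative (hex_torus A) (at x) w =
      (\<Sum>i\<in>UNIV. F (index6 i))"
    by (simp add: inner_vec_def[of "frechet_derivative (hex_torus A) (at x) v"] hex_torus_derivative_nth wave_def F_def power2_eq_square mult_ac)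
  also have "\<dots> = (\<Sum>j<3. F (2 * j) + F (2 * j + 1))" by (rule sum_index6)
  also have "\<dots> = (\<Sum>j<3. ((sin (?y j))\<^sup>2 + (cos (?y j))\<^sup>2) *
      (4 * pi\<^sup>2 * ((A j)\<^sup>2 * (hex_direction j \<bullet> v) * (hex_direction j \<bullet> w))))"
    unfolding distrib_right by (intro sum.cong refl arg_cong2[where f = "(+)"]) (simp_all add: F_def cos_add)
  finally show ?thesis by (simp add: sum_distrib_left)
qed

lemma hex_torus_norm: "(norm (hex_torus A x))\<^sup>2 = (\<Sum>j<3. (A j)\<^sup>2)"
proof -
  let ?y = "\<lambda>j. 2 * pi * (hex_direction j \<bullet> x)"
  define F where "F n = (cos (?y (n div 2) - real (n mod 2) * (pi / 2)))\<^sup>2 * (A (n div 2))\<^sup>2" for n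
  have "(norm (hex_torus A x))\<^sup>2 = (\<Sum>i\<in>UNIV. F (index6 i))"
    by (simp only: power2_norm_eq_inner inner_vec_def)
       (simp add: hex_torus_nth wave_def F_def power2_eq_square mult_ac)
  also have "\<dots> = (\<Sum>j<3. F (2 * j) + F (2 * j + 1))" by (rule sum_index6)
  also have "\<dots> = (\<Sum>j<3. ((cos (?y j))\<^sup>2 + (sin (?y j))\<^sup>2) * (A j)\<^sup>2)"
    unfolding distrib_right by (intro sum.cong refl arg_cong2[where f = "(+)"]) (simp_all add: F_def cos_diff)
  finally show ?thesis by simp
qed

lemma mean_hex_torus: "mean (hex_torus A) = 0"
proof -
  have "mean (hex_torus A) = (\<Sum>i\<in>UNIV. mean (wave ((2 * pi) *\<^sub>R hex_direction (index6 i div 2))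
      (- (real (index6 i mod 2) * (pi / 2))) (axis i (A (index6 i div 2)))))"
    unfolding hex_torus_def[abs_def]
    by (rule mean_sum) (auto intro: cont_periodic_wave hex_direction_lattice)
  then show ?thesis by (simp add: mean_wave hex_direction_lattice hex_direction_nonzero)
qed

text \<open>The first two circles determine \<open>x\<close> and \<open>y\<close> modulo \<open>1\<close>.\<close>

lemma hex_torus_injective:
  assumes A: "A 0 \<noteq> 0" "A 1 \<noteq> 0" and eq: "hex_torus A x = hex_torus A y"
  shows "x - y \<in> lattice"
proof -
  have Z: "s - t \<in> \<int>" if "sin (2 * pi * s) = sin (2 * pi * t)" "cos (2 * pi * s) = cos (2 * pi * t)" for s t :: real
  proof -
    have "\<exists>n::int. 2 * pi * s = 2 * pi * t + 2 * pi * n"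
      using sin_cos_eq_iff[of "2 * pi * s" "2 * pi * t"] that by auto
    then obtain n :: int where "2 * pi * s = 2 * pi * t + 2 * pi * n" by blast
    then have "2 * pi * (s - t) = 2 * pi * n" by (simp add: right_diff_distrib)
    then have "s - t = n" using pi_neq_zero by simp
    then show ?thesis by simp
  qed
  have comp: "hex_torus A x $ of_nat n = hex_torus A y $ of_nat n" for n by (simp add: eq)
  have "x $ 1 - y $ 1 \<in> \<int>" "x $ 2 - y $ 2 \<in> \<int>"
    using comp[of 0] comp[of 1] comp[of 2] comp[of 3] A index6_of_nat[of 0] index6_of_nat[of 1] index6_of_nat[of 2] index6_of_nat[of 3]
    by (intro Z; simp add: hex_torus_nth wave_def inner_vec_def sum_2 cos_diff)+
  then show ?thesis by (simp add: lattice_def forall_2)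
qed

text \<open>The pullback metric is \<open>4\<pi>\<^sup>2 (A\<^sub>0\<^sup>2 dx\<^sup>2 + A\<^sub>1\<^sup>2 dy\<^sup>2 + A\<^sub>2\<^sup>2 (dx + dy)\<^sup>2)\<close>; the conditions on \<open>A\<close> compare its
  coefficients with those of \<open>c (dx\<^sup>2 + 2a dx dy + (a\<^sup>2 + b\<^sup>2) dy\<^sup>2)\<close>, and the inequalities make the
  first two circles nondegenerate.\<close>

lemma isometric_embedding_hex_torus:
  assumes "a < 1" "a < a\<^sup>2 + b\<^sup>2" "0 < c"
    and A: "4 * pi\<^sup>2 * (A 0)\<^sup>2 = c * (1 - a)" "4 * pi\<^sup>2 * (A 1)\<^sup>2 = c * (a\<^sup>2 + b\<^sup>2 - a)"
      "4 * pi\<^sup>2 * (A 2)\<^sup>2 = c * a"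
  shows "isometric_embedding (\<lambda>x. c *\<^sub>R h_flat a b x) (hex_torus A)"
  unfolding isometric_embedding_def
proof (intro conjI allI impI)
  show "smooth (hex_torus A)"
    unfolding hex_torus_def[abs_def] by (intro smooth_sum smooth_wave) simp
  show "periodic (hex_torus A)"
    using periodic_wave[OF hex_direction_lattice]
    unfolding periodic_def vec_eq_iff hex_torus_nth by blast
  have "A 0 \<noteq> 0" "A 1 \<noteq> 0" using A assms by auto
  then show "x - y \<in> lattice" if "hex_torus A x = hex_torus A y" for x y
    using hex_torus_injective that by blast
  fix x v w :: "real ^ 2"
  have "4 * pi\<^sup>2 * (\<Sum>j<3. (A j)\<^sup>2 * (hex_direction j \<bullet> v) * (hex_direction j \<bullet> w)) =
      (4 * pi\<^sup>2 * (A 0)\<^sup>2) * (v $ 1 * w $ 1) + (4 * pi\<^sup>2 * (A 1)\<^sup>2) * (v $ 2 * w $ 2)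
      + (4 * pi\<^sup>2 * (A 2)\<^sup>2) * ((v $ 1 + v $ 2) * (w $ 1 + w $ 2))"
    by (simp add: sum_lessThan_3 inner_vec_def sum_2 algebra_simps)
  also have "\<dots> = v \<bullet> ((c *\<^sub>R h_flat a b x) *v w)"
    unfolding A by (simp add: h_flat_def inner_vec_def matrix_vector_mult_def sum_2 algebra_simps)
  finally show "frechet_derivative (hex_torus A) (at x) v \<bullet> frechet_derivative (hex_torus A) (at x) w =
      v \<bullet> ((c *\<^sub>R h_flat a b x) *v w)"
    by (simp add: hex_torus_inner_derivative)
qed

section \<open>The maximizers\<close>

lemma h_EL_parameters: "(1 / 2 :: real)\<^sup>2 + (sqrt 3 / 2)\<^sup>2 = 1" "0 < sqrt 3 / 2"
  by (simp_all add: power_divide)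

lemma hex_torus_by_first_eigenfunctions: "by_first_eigenfunctions h_EL (hex_torus A)"
  unfolding by_first_eigenfunctions_def h_EL_def
proof (intro exI conjI allI)
  show "is_first_eigenvalue (h_flat (1 / 2) (sqrt 3 / 2)) (4 * pi\<^sup>2 / (sqrt 3 / 2)\<^sup>2)"
    by (rule first_eigenvalue) (simp_all add: power_divide)
  show "(\<lambda>x. hex_torus A x $ i) \<in> eigenspace (h_flat (1 / 2) (sqrt 3 / 2)) (4 * pi\<^sup>2 / (sqrt 3 / 2)\<^sup>2)" for i
    unfolding hex_torus_nth
    using wave_eigenspace[OF h_EL_parameters(2,1) hex_direction_lattice hex_form_hex_direction] by simp
qed

lemma mean_pairing_flat_dual:
  assumes "s\<^sup>2 + t\<^sup>2 = 1"
  shows "mean (pairing (\<lambda>_. flat_dual s t) (\<lambda>x. c *\<^sub>R h_flat a b x)) = c * (1 - 2 * s * a + a\<^sup>2 + b\<^sup>2) / t\<^sup>2"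
proof -
  have "pairing (\<lambda>_. flat_dual s t) (\<lambda>x. c *\<^sub>R h_flat a b x) = (\<lambda>_. c * (1 - 2 * s * a + a\<^sup>2 + b\<^sup>2) / t\<^sup>2)"
    by (simp add: fun_eq_iff pairing_def flat_dual_def h_flat_def sum_2 assms algebra_simps
        add_divide_distrib diff_divide_distrib)
  then show ?thesis by (simp add: mean_const)
qed

theorem proposition3p1:
  fixes a b c :: real and h :: tensor_field
  assumes "0 \<le> a" and "a \<le> 1 / 2" and "b \<ge> sqrt (1 - a\<^sup>2)" and "c > 0"
    and "h = (\<lambda>x. c *\<^sub>R h_flat a b x)"
  shows "(\<exists>\<phi> :: real ^ 2 \<Rightarrow> real ^ 6.
            isometric_embedding h \<phi> \<and>
            by_first_eigenfunctions h_EL \<phi> \<and>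
            inflated (volume_density h) h (l2_of_R6 \<circ> \<phi>) \<and>
            (a = 0 \<longrightarrow> (\<exists>S :: 6 set. card S = 4 \<and> (\<forall>x i. i \<notin> S \<longrightarrow> \<phi> x $ i = 0)))) \<and>
         solves_maximization (volume_density h) h (dual_metric h_EL) \<and>
         (a = 0 \<longrightarrow>
            dual_metric h_SQ \<noteq> dual_metric h_EL \<and>
            solves_maximization (volume_density h) h (dual_metric h_SQ) \<and>
            (\<forall>a'. 0 \<le> a' \<and> a' \<le> 1 / 2 \<longrightarrow>
               solves_maximization (volume_density h) h
                 (dual_metric (h_flat a' (sqrt (1 - a'\<^sup>2))))))"
proof -
  have a2: "a\<^sup>2 < 1" using power_mono[OF assms(2,1), of 2] by (simp add: power_divide)
  have b: "0 < b" using a2 assms(3) real_sqrt_gt_zero[of "1 - a\<^sup>2"] by linarith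
  have "1 - a\<^sup>2 \<le> b\<^sup>2" using power_mono[OF assms(3), of 2] a2 by simp
  then have ab: "1 \<le> a\<^sup>2 + b\<^sup>2" by simp
  define \<rho> where "\<rho> = c * b"
  have \<rho>: "\<rho> \<noteq> 0" using assms b by (simp add: \<rho>_def)
  have vol: "volume_density h = (\<lambda>_. \<rho>)"
    using volume_density_h_flat[OF b assms(4), of a] by (simp add: assms(5) \<rho>_def)
  \<comment> \<open>The radii for which the pullback metric is \<open>h\<close>; the radicands are nonnegative by \<open>ab\<close>.\<close>
  define A where "A j = sqrt (c * (if j = 0 then 1 - a else if j = 1 then a\<^sup>2 + b\<^sup>2 - a else a)) / (2 * pi)"
    for j :: nat
  have A2: "4 * pi\<^sup>2 * (A j)\<^sup>2 = c * (if j = 0 then 1 - a else if j = 1 then a\<^sup>2 + b\<^sup>2 - a else a)" for j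
    using assms(1,2,4) ab by (simp add: A_def power_divide power_mult_distrib)
  let ?\<phi> = "hex_torus A"
  have emb: "isometric_embedding h ?\<phi>"
    unfolding assms(5) by (rule isometric_embedding_hex_torus) (use assms(1,2,4) ab A2 in auto)
  have R: "4 * pi\<^sup>2 * mean (\<lambda>x. (norm (?\<phi> x))\<^sup>2) = c * (1 - a + a\<^sup>2 + b\<^sup>2)"
    by (simp add: hex_torus_norm mean_const sum_lessThan_3 distrib_left A2) (simp add: algebra_simps)
  \<comment> \<open>The condition \<open>a \<le> 2 s a\<close> holds for \<open>s = 1/2\<close>, and for every \<open>s\<close> if \<open>a = 0\<close>.\<close>
  have sharp: "mean (pairing (\<lambda>_. flat_dual s t) h) \<le> 4 * pi\<^sup>2 / t\<^sup>2 * mean (\<lambda>x. (norm (?\<phi> x))\<^sup>2)"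
    if st: "s\<^sup>2 + t\<^sup>2 = 1" and s: "a \<le> 2 * s * a" for s t
  proof -
    have "c * (1 - 2 * s * a + a\<^sup>2 + b\<^sup>2) / t\<^sup>2 \<le> c * (1 - a + a\<^sup>2 + b\<^sup>2) / t\<^sup>2"
      using s assms(4) by (intro divide_right_mono mult_left_mono) auto
    then show ?thesis
      unfolding assms(5) mean_pairing_flat_dual[OF st] R[symmetric] by simp
  qed
  have sol: "solves_maximization (volume_density h) h (dual_metric (h_flat s t))"
    if s: "0 \<le> s" "s \<le> 1/2" and t: "0 < t" and st: "s\<^sup>2 + t\<^sup>2 = 1" and sa: "a \<le> 2 * s * a" for s t
    unfolding vol dual_metric_h_flat[OF less_imp_neq[OF t, symmetric]]
  proof (rule solves_maximizationI[OF \<rho> emb mean_hex_torus flat_dual_in_M_star[OF st]])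
    have "2 * s * a \<le> 1 * a" using s assms(1) by (intro mult_right_mono) auto
    then show "0 < mean (pairing (\<lambda>_. flat_dual s t) h)"
      unfolding assms(5) mean_pairing_flat_dual[OF st] using t assms(1,2,4) ab by auto
    have "4 * pi\<^sup>2 / t\<^sup>2 \<le> lambda1 (\<lambda>_. \<rho>) (\<lambda>_. flat_dual s t)"
      by (rule lambda1_geI[OF \<rho> unit_circle_poincare[OF s st]])
    from mult_right_mono[OF this mean_nonneg[of "\<lambda>x. (norm (?\<phi> x))\<^sup>2"]]
    show "mean (pairing (\<lambda>_. flat_dual s t) h) \<le>
        lambda1 (\<lambda>_. \<rho>) (\<lambda>_. flat_dual s t) * mean (\<lambda>x. (norm (?\<phi> x))\<^sup>2)"
      using sharp[OF st sa] by simp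
  qed
  have h: "cont_periodic (\<lambda>x. h x $ i $ j)" for i j
    by (simp add: assms(5) h_flat_def)
  have infl: "inflated (volume_density h) h (l2_of_R6 \<circ> ?\<phi>)"
    unfolding vol
    by (rule inflatedI[OF \<rho>, of "1/2" "sqrt 3 / 2"])
      (use h_EL_parameters h sharp[OF h_EL_parameters(1)] emb mean_hex_torus in auto)
  \<comment> \<open>For \<open>a = 0\<close> the third radius vanishes, and with it the last two coordinates.\<close>
  have R4: "\<exists>S :: 6 set. card S = 4 \<and> (\<forall>x i. i \<notin> S \<longrightarrow> ?\<phi> x $ i = 0)" if "a = 0"
  proof (intro exI conjI allI impI)
    let ?S = "of_nat ` {..<4} :: 6 set"
    have "inj_on (of_nat :: nat \<Rightarrow> 6) {..<4}"
      using bij_betw_of_nat_6 by (auto simp: bij_betw_def intro: inj_on_subset)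
    then show "card ?S = 4" by (simp add: card_image)
    fix x i assume i: "i \<notin> ?S"
    have "of_nat (index6 i) = i"
      using bij_betw_inv_into_right[OF bij_betw_of_nat_6] by (simp add: index6_def)
    then have "4 \<le> index6 i" using i by (metis imageI lessThan_iff not_less)
    then have "2 \<le> index6 i div 2" by simp
    then show "?\<phi> x $ i = 0" by (simp add: hex_torus_nth wave_def A_def that)
  qed
  have "dual_metric h_SQ \<noteq> dual_metric h_EL"
  proof
    assume "dual_metric h_SQ = dual_metric h_EL"
    then have "flat_dual 0 1 $ 1 $ 2 = flat_dual (1/2) (sqrt 3 / 2) $ 1 $ 2"
      by (simp add: h_SQ_def h_EL_def dual_metric_h_flat fun_eq_iff)
    then show False by (simp add: flat_dual_def)
  qed
  moreover have "solves_maximization (volume_density h) h (dual_metric h_EL)"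
    unfolding h_EL_def by (rule sol) (use h_EL_parameters in auto)
  moreover have circ: "solves_maximization (volume_density h) h (dual_metric (h_flat a' (sqrt (1 - a'\<^sup>2))))"
    if "a = 0" "0 \<le> a'" "a' \<le> 1 / 2" for a'
  proof -
    have "a'\<^sup>2 < 1" using power_mono[OF that(3,2), of 2] by (simp add: power_divide)
    then show ?thesis using that by (intro sol) auto
  qed
  moreover have "solves_maximization (volume_density h) h (dual_metric h_SQ)" if "a = 0"
    using circ[of 0] that by (simp add: h_SQ_def)
  ultimately show ?thesis
    using emb infl R4 hex_torus_by_first_eigenfunctions by blast
qed

end
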